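(* Let $\mu>0$, $p\in[4,6)$, and let $\mathcal{G}$ be a metric graph obtained from a compact core $\mathcal{K}$ by attaching $N\ge2$ half-lines, as described in the context. Let $(\mathcal{G}_i)_{i=1}^{\nu}$ be a partition of $\mathcal{G}$ and let $\mathcal{K}_i=\mathcal{G}_i\cap\mathcal{K}$ for $i=1,\dots,\nu$. Let $$L_2=\mu^{\frac{2-p}{6-p}}\,\mathcal{C}_p^{\frac{4-p}{6-p}}\,\mathcal{C}_\infty^{-p},$$ where $\mathcal{C}_p,\mathcal{C}_\infty$ are the Gagliardo--Nirenberg constants described in the context. If $$\operatorname{meas}(\mathcal{K}_i)<L_2\qquad\text{for all } i=1,\dots,\nu,$$ then the minimum $\min_{u\in H^1_\mu(\mathcal{G})}E(u,\mathcal{G})$ is not attained, i.e. there is no $u\in H^1_\mu(\mathcal{G})$ with $E(u,\mathcal{G})=\inf_{v\in H^1_\mu(\mathcal{G})}E(v,\mathcal{G})$.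
   Context: Graphs are multigraphs (multiple edges and self-loops are allowed, and there is no constraint on the degree of the vertices). A metric graph is a connected graph in which each edge $e$ of length $l_e$ is identified with an interval $I_e=[0,l_e]$ if $l_e<\infty$, and with $I_e=[0,+\infty)$ if $l_e=+\infty$; in the latter case $e$ is called a half-line and $x_e=0$ is its starting point. Let $\mathcal{K}=(\mathrm{V}_{\mathcal{K}},\mathrm{E}_{\mathcal{K}})$ be a nontrivial compact connected metric graph, i.e. one with finitely many vertices and edges, at least one edge, and all edges of finite positive length (no half-lines). The measure $\operatorname{meas}$ of a graph is the sum of the lengths of its edges (it is $0$ if there are no edges). Let $\mathcal{R}_1,\dots,\mathcal{R}_N$ be half-lines, each starting from a vertex of $\mathcal{K}$ (the starting vertices need not be distinct) and ending at distinct vertices at infinity. The graph $\mathcal{G}$ has vertices those of $\mathcal{K}$ together with the $N$ vertices at infinity, and edges $\mathrm{E}=\mathrm{E}_{\mathcal{K}}\cup\{\mathcal{R}_1,\dots,\mathcal{R}_N\}$. A function $u:\mathcal{G}\to\mathbb{R}$ is a family $(u_e)_{e\in\mathrm{E}}$ with $u_e:I_e\to\mathbb{R}$. One sets $\|u\|_{L^q(\mathcal{G})}^q=\sum_{e\in\mathrm{E}}\|u_e\|_{L^q(I_e)}^q$ and $\|u\|_{L^q(\mathcal{K})}^q=\sum_{e\in\mathrm{E}_{\mathcal{K}}}\|u_e\|_{L^q(I_e)}^q$; $\|u\|_{L^\infty(\mathcal{G})}$ is the essential supremum of $|u|$ on $\mathcal{G}$. The space $H^1(\mathcal{G})$ consists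 of the functions $u=(u_e)_{e\in\mathrm{E}}$ that are continuous on $\mathcal{G}$ (in particular at the vertices of $\mathcal{K}$) and satisfy $u_e\in H^1(I_e)$ for every $e\in\mathrm{E}$. For $\mu>0$, $H^1_\mu(\mathcal{G})=\{u\in H^1(\mathcal{G}):\|u\|_{L^2(\mathcal{G})}^2=\mu\}$. The energy functional is $$E(u,\mathcal{G})=\tfrac12\|u'\|_{L^2(\mathcal{G})}^2-\tfrac1p\|u\|_{L^p(\mathcal{K})}^p=\tfrac12\sum_{e\in\mathrm{E}}\int_{I_e}|u_e'|^2\,dx_e-\tfrac1p\sum_{e\in\mathrm{E}_{\mathcal{K}}}\int_{I_e}|u_e|^p\,dx_e .$$ Partition: for $N\ge2$ and $2\le\nu\le N$, a family $(\mathcal{G}_i)_{i=1}^{\nu}$ of nontrivial connected subgraphs of $\mathcal{G}$ (each consisting of edges and vertices of $\mathcal{G}$) is a partition of $\mathcal{G}$ if: (1) $\bigcup_{i=1}^{\nu}\mathcal{G}_i=\mathcal{G}$; (2) $\operatorname{meas}(\mathcal{G}_i\cap\mathcal{G}_l)=0$ whenever $i\ne l$; (3) for every $i\in\{1,\dots,\nu\}$ there exists $j\in\{1,\dots,N\}$ such that $\mathcal{R}_j\subset\mathcal{G}_i$. It is allowed that some $\mathcal{K}_i=\mathcal{G}_i\cap\mathcal{K}$ contains no edge. Gagliardo--Nirenberg constants: $\mathcal{C}_p$ (depending only on $p$) and $\mathcal{C}_\infty$ denote positive constants such that, for every metric graph $\mathcal{H}$ consisting of a compact connected core with at least one half-line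 attached in the manner above, $$\|u\|_{L^p(\mathcal{H})}^p\le\mathcal{C}_p\|u\|_{L^2(\mathcal{H})}^{\frac p2+1}\|u'\|_{L^2(\mathcal{H})}^{\frac p2-1},\qquad \|u\|_{L^\infty(\mathcal{H})}\le\mathcal{C}_\infty\|u\|_{L^2(\mathcal{H})}^{1/2}\|u'\|_{L^2(\mathcal{H})}^{1/2}\qquad\forall u\in H^1(\mathcal{H}).$$ Such constants, independent of $\mathcal{H}$, exist. *)

theory Defs
  imports
    "Graph_Theory.Digraph_Component"
    "HOL-Analysis.Analysis"
    "HOL-Probability.Essential_Supremum"
begin

section \<open>Metric graphs with a compact core and half-lines\<close>

text \<open>
  A multigraph is a \<^typ>\<open>('v, 'e) pre_digraph\<close> (parallel arcs and loops allowed) together with a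
  length function \<open>len :: 'e \<Rightarrow> ennreal\<close>. The direction of an arc only fixes the coordinate on the
  edge: \<open>tail e\<close> sits at \<open>x = 0\<close> and \<open>head e\<close> at \<open>x = len e\<close>. Hence a half-line starts at its
  tail, and its head is a vertex at infinity. Connectedness
  (\<^const>\<open>Digraph_Component.connected\<close>) ignores directions and includes nonemptiness of the vertex set.
\<close>

definition half_lines :: "('v, 'e) pre_digraph \<Rightarrow> ('e \<Rightarrow> ennreal) \<Rightarrow> 'e set" where
  "half_lines G len = {e \<in> arcs G. len e = \<infinity>}"

definition compact_core :: "('v, 'e) pre_digraph \<Rightarrow> ('e \<Rightarrow> ennreal) \<Rightarrow> ('v, 'e) pre_digraph" where
  "compact_core G len =
     \<lparr> verts = verts G - head G ` half_lines G len, arcs = arcs G - half_lines G len,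
       tail = tail G, head = head G \<rparr>"

text \<open>
  The assumptions \<open>wf_core\<close> and \<open>tail_half_line\<close> say that a vertex at infinity is not an
  endpoint of a core edge nor the starting point of a half-line. The core may be a single vertex
  without edges; nontriviality is a separate hypothesis where it is needed.
\<close>

locale core_with_half_lines = fin_digraph G
  for G :: "('v, 'e) pre_digraph" +
  fixes len :: "'e \<Rightarrow> ennreal"
  assumes len_pos: "e \<in> arcs G \<Longrightarrow> 0 < len e"
    and wf_core: "wf_digraph (compact_core G len)"
    and core_connected: "Digraph_Component.connected (compact_core G len)"
    and tail_half_line: "e \<in> half_lines G len \<Longrightarrow> tail G e \<in> verts (compact_core G len)"
    and inj_head_half_line: "inj_on (head G) (half_lines G len)"

definition meas :: "('v, 'e) pre_digraph \<Rightarrow> ('e \<Rightarrow> ennreal) \<Rightarrow> ennreal" where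
  "meas G len = (\<Sum>e\<in>arcs G. len e)"

definition graph_inter ::
    "('v, 'e) pre_digraph \<Rightarrow> ('v, 'e) pre_digraph \<Rightarrow> ('v, 'e) pre_digraph" where
  "graph_inter G H =
     \<lparr> verts = verts G \<inter> verts H, arcs = arcs G \<inter> arcs H, tail = tail G, head = head G \<rparr>"

text \<open>The number of half-lines is \<open>N = card (half_lines G len)\<close>.\<close>

definition graph_partition ::
    "('v, 'e) pre_digraph \<Rightarrow> ('e \<Rightarrow> ennreal) \<Rightarrow> nat \<Rightarrow> (nat \<Rightarrow> ('v, 'e) pre_digraph) \<Rightarrow> bool" where
  "graph_partition G len \<nu> Gs \<longleftrightarrow>
     2 \<le> \<nu> \<and> \<nu> \<le> card (half_lines G len) \<and>
     (\<forall>i\<in>{1..\<nu>}. subgraph (Gs i) G \<and> arcs (Gs i) \<noteq> {} \<and> Digraph_Component.connected (Gs i)) \<and>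
     pre_digraph.Union G (Gs ` {1..\<nu>}) = G \<and>
     (\<forall>i\<in>{1..\<nu>}. \<forall>l\<in>{1..\<nu>}. i \<noteq> l \<longrightarrow> meas (graph_inter (Gs i) (Gs l)) len = 0) \<and>
     (\<forall>i\<in>{1..\<nu>}. \<exists>h\<in>half_lines G len. h \<in> arcs (Gs i))"


section \<open>Function spaces\<close>

definition edge_interval :: "('e \<Rightarrow> ennreal) \<Rightarrow> 'e \<Rightarrow> real set" where
  "edge_interval len e = {x. 0 \<le> x \<and> ennreal x \<le> len e}"

definition L2_on :: "real set \<Rightarrow> (real \<Rightarrow> real) \<Rightarrow> bool" where
  "L2_on I f \<longleftrightarrow> set_borel_measurable lborel I f \<and> set_integrable lborel I (\<lambda>x. (f x)\<^sup>2)"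

definition test_function :: "real set \<Rightarrow> (real \<Rightarrow> real) \<Rightarrow> bool" where
  "test_function S \<phi> \<longleftrightarrow>
     \<phi> C1_differentiable_on UNIV \<and>
     compact (closure {x. \<phi> x \<noteq> 0}) \<and> closure {x. \<phi> x \<noteq> 0} \<subseteq> S"

text \<open>Weak derivatives in \<open>L\<^sup>2(I)\<close>, tested against \<open>C\<^sub>c\<^sup>1\<close> functions on the interior of \<open>I\<close>.\<close>

definition has_weak_deriv :: "real set \<Rightarrow> (real \<Rightarrow> real) \<Rightarrow> (real \<Rightarrow> real) \<Rightarrow> bool" where
  "has_weak_deriv I f g \<longleftrightarrow>
     L2_on I g \<and>
     (\<forall>\<phi>. test_function (interior I) \<phi> \<longrightarrow>
        (LINT x:I|lborel. f x * deriv \<phi> x) = - (LINT x:I|lborel. g x * \<phi> x))"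

definition H1_on :: "real set \<Rightarrow> (real \<Rightarrow> real) \<Rightarrow> bool" where
  "H1_on I f \<longleftrightarrow> L2_on I f \<and> (\<exists>g. has_weak_deriv I f g)"

text \<open>A representative; it is unique up to a null set on \<open>I\<close> whenever \<open>H1_on I f\<close>.\<close>

definition weak_deriv :: "real set \<Rightarrow> (real \<Rightarrow> real) \<Rightarrow> (real \<Rightarrow> real)" where
  "weak_deriv I f = (SOME g. has_weak_deriv I f g)"

text \<open>
  A function on the graph is a family \<open>u :: 'e \<Rightarrow> real \<Rightarrow> real\<close>; only the values \<open>u e x\<close> with
  \<open>e \<in> arcs G\<close> and \<open>x \<in> edge_interval len e\<close> matter.
\<close>

definition graph_deriv :: "('e \<Rightarrow> ennreal) \<Rightarrow> ('e \<Rightarrow> real \<Rightarrow> real) \<Rightarrow> ('e \<Rightarrow> real \<Rightarrow> real)" where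
  "graph_deriv len u = (\<lambda>e. weak_deriv (edge_interval len e) (u e))"

text \<open>
  In the next definition \<open>c v\<close> is the value at the vertex \<open>v\<close>, common to all edge ends meeting
  there. Nothing is required at vertices at infinity.
\<close>

definition continuous_on_graph ::
    "('v, 'e) pre_digraph \<Rightarrow> ('e \<Rightarrow> ennreal) \<Rightarrow> ('e \<Rightarrow> real \<Rightarrow> real) \<Rightarrow> bool" where
  "continuous_on_graph G len u \<longleftrightarrow>
     (\<forall>e\<in>arcs G. continuous_on (edge_interval len e) (u e)) \<and>
     (\<exists>c. \<forall>e\<in>arcs G. u e 0 = c (tail G e) \<and>
        (len e < \<infinity> \<longrightarrow> u e (enn2real (len e)) = c (head G e)))"

definition H1 ::
    "('v, 'e) pre_digraph \<Rightarrow> ('e \<Rightarrow> ennreal) \<Rightarrow> ('e \<Rightarrow> real \<Rightarrow> real) set" where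
  "H1 G len =
     {u. continuous_on_graph G len u \<and> (\<forall>e\<in>arcs G. H1_on (edge_interval len e) (u e))}"

definition Lq_norm ::
    "('v, 'e) pre_digraph \<Rightarrow> ('e \<Rightarrow> ennreal) \<Rightarrow> real \<Rightarrow> ('e \<Rightarrow> real \<Rightarrow> real) \<Rightarrow> real" where
  "Lq_norm G len q u =
     (\<Sum>e\<in>arcs G. LINT x:edge_interval len e|lborel. \<bar>u e x\<bar> powr q) powr (1 / q)"

definition Linf_norm ::
    "('v, 'e) pre_digraph \<Rightarrow> ('e \<Rightarrow> ennreal) \<Rightarrow> ('e \<Rightarrow> real \<Rightarrow> real) \<Rightarrow> ennreal" where
  "Linf_norm G len u =
     (SUP e\<in>arcs G. esssup (restrict_space lborel (edge_interval len e)) (\<lambda>x. ennreal \<bar>u e x\<bar>))"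

definition H1_mass ::
    "('v, 'e) pre_digraph \<Rightarrow> ('e \<Rightarrow> ennreal) \<Rightarrow> real \<Rightarrow> ('e \<Rightarrow> real \<Rightarrow> real) set" where
  "H1_mass G len \<mu> = {u \<in> H1 G len. (Lq_norm G len 2 u)\<^sup>2 = \<mu>}"

definition energy ::
    "('v, 'e) pre_digraph \<Rightarrow> ('e \<Rightarrow> ennreal) \<Rightarrow> real \<Rightarrow> ('e \<Rightarrow> real \<Rightarrow> real) \<Rightarrow> real" where
  "energy G len p u =
     1 / 2 * (Lq_norm G len 2 (graph_deriv len u))\<^sup>2 -
     1 / p * Lq_norm (compact_core G len) len p u powr p"


section \<open>Gagliardo--Nirenberg constants\<close>

text \<open>
  The constants are uniform over all metric graphs \<open>H\<close> with at least one half-line. As HOL cannot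
  quantify over types inside a formula, \<open>H\<close> ranges over graphs labelled by natural numbers;
  since all graphs here are finite, this covers every such graph up to relabelling.
\<close>

definition GN_const_Lp :: "real \<Rightarrow> real \<Rightarrow> bool" where
  "GN_const_Lp p C \<longleftrightarrow>
     (\<forall>(H :: (nat, nat) pre_digraph) len.
        core_with_half_lines H len \<and> half_lines H len \<noteq> {} \<longrightarrow>
        (\<forall>u\<in>H1 H len.
           Lq_norm H len p u powr p
             \<le> C * Lq_norm H len 2 u powr (p / 2 + 1)
                 * Lq_norm H len 2 (graph_deriv len u) powr (p / 2 - 1)))"

definition GN_const_Linf :: "real \<Rightarrow> bool" where
  "GN_const_Linf C \<longleftrightarrow>
     (\<forall>(H :: (nat, nat) pre_digraph) len.
        core_with_half_lines H len \<and> half_lines H len \<noteq> {} \<longrightarrow>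
        (\<forall>u\<in>H1 H len.
           Linf_norm H len u
             \<le> ennreal (C * Lq_norm H len 2 u powr (1 / 2)
                          * Lq_norm H len 2 (graph_deriv len u) powr (1 / 2))))"

definition threshold_L2 :: "real \<Rightarrow> real \<Rightarrow> real \<Rightarrow> real \<Rightarrow> real" where
  "threshold_L2 p \<mu> Cp Cinf =
     \<mu> powr ((2 - p) / (6 - p)) * Cp powr ((4 - p) / (6 - p)) * Cinf powr (- p)"

end

theory Submission
  imports Defs "Graph_Theory.Digraph_Isomorphism" "HOL-Real_Asymp.Real_Asymp"
begin

text \<open>
  The infimum of the energy is never positive: a function supported on one half-line feels only
  the kinetic term, and stretching it at fixed mass sends that term to zero
  (\<open>half_line_trial_function\<close>, \<open>minimal_energy_nonpos\<close>). A minimiser \<open>u\<close> would therefore satisfy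
  \<open>T / 2 \<le> A / p\<close>, where \<open>T = \<parallel>u'\<parallel>\<^sup>2\<close> and \<open>A\<close> is the \<open>p\<close>-th power of the \<open>L\<^sup>p\<close> norm of \<open>u\<close> on the
  core. Small core pieces make \<open>A\<close> too small for this.

  Each piece \<open>G\<^sub>i\<close> of the partition contains a half-line and is again a core with half-lines, so the
  supremum inequality applies on it. With mass \<open>\<mu>\<^sub>i\<close> and kinetic part \<open>T\<^sub>i\<close> of \<open>u\<close> on \<open>G\<^sub>i\<close> it bounds
  the share of \<open>G\<^sub>i\<close> in \<open>A\<close> by \<open>Cinf powr p * (\<mu>\<^sub>i * T\<^sub>i) powr (p / 4)\<close> times the measure of the core
  part of \<open>G\<^sub>i\<close> (\<open>core_Lp_bound\<close>). Because \<open>p / 4 \<ge> 1\<close>, summing over the pieces gives at most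
  \<open>Cinf powr p * L * (\<mu> * T) powr (p / 4)\<close>, with \<open>L\<close> the threshold for the single pieces and not
  for the whole core (\<open>sum_powr_mult_powr_le\<close>). The \<open>L\<^sup>p\<close> inequality on the whole graph bounds \<open>A\<close> by
  a multiple of \<open>T powr ((p - 2) / 4)\<close>, and since this exponent is less than one, it bounds \<open>T\<close>
  from above. Together the two bounds contradict
  \<open>T / 2 \<le> A / p\<close>, as \<open>T > 0\<close> (\<open>H1_kinetic_pos\<close>, \<open>threshold_contradiction\<close>).

  Two points take some work. The energy involves an arbitrarily chosen weak derivative, so the energy
  of a trial function is only known once weak derivatives are unique almost everywhere
  (\<open>weak_deriv_unique\<close>). And a piece must be shown to have a connected core and be relabelled by
  natural numbers before the inequalities apply to it (\<open>connected_subgraph_core_with_half_lines\<close>,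
  \<open>GN_const_LpD\<close>, \<open>GN_const_LinfD\<close>).
\<close>

section \<open>Pieces of a partition as graphs with half-lines\<close>

lemma compact_core_simps [simp]:
  "verts (compact_core G len) = verts G - head G ` half_lines G len"
  "arcs (compact_core G len) = arcs G - half_lines G len"
  "tail (compact_core G len) = tail G"
  "head (compact_core G len) = head G"
  by (simp_all add: compact_core_def)

text \<open>
  A map that sends the ends of every arc to equal or adjacent vertices carries paths of \<open>G\<close> to
  paths of \<open>H\<close>. If it also fixes the vertices of \<open>H\<close>, these paths join any two of them.
\<close>

lemma connected_retract:
  assumes con: "Digraph_Component.connected G"
    and r: "r ` verts G \<subseteq> verts H" "\<And>v. v \<in> verts H \<Longrightarrow> v \<in> verts G \<and> r v = v"
    and arc: "\<And>e. e \<in> arcs G \<Longrightarrow>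
      r (tail G e) = r (head G e) \<or> (r (tail G e), r (head G e)) \<in> arcs_ends H"
  shows "Digraph_Component.connected H"
proof -
  have *: "(r u, r v) \<in> rtrancl_on (verts H) ((arcs_ends H)\<^sup>s)"
    if "(u, v) \<in> rtrancl_on (verts G) ((arcs_ends G)\<^sup>s)" for u v
    using that
  proof (induction rule: rtrancl_on_induct)
    case base
    then show ?case using r(1) by auto
  next
    case (step y z)
    have "r y = r z \<or> (r y, r z) \<in> (arcs_ends H)\<^sup>s"
    proof -
      from step(2) obtain e where e: "e \<in> arcs G"
        "(y = tail G e \<and> z = head G e) \<or> (y = head G e \<and> z = tail G e)"
        by (auto simp: symcl_def arcs_ends_def arc_to_ends_def)
      then show ?thesis using arc[OF e(1)] by (auto simp: symcl_def)
    qed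
    moreover have "r z \<in> verts H" using step r(1) by auto
    ultimately show ?case using step(5) by (auto intro: rtrancl_on_into_rtrancl_on)
  qed
  show ?thesis unfolding connected_conv
  proof (intro conjI ballI)
    show "verts H \<noteq> {}" using con r(1) by (auto simp: connected_conv)
    fix u v assume uv: "u \<in> verts H" "v \<in> verts H"
    then have "(u, v) \<in> rtrancl_on (verts G) ((arcs_ends G)\<^sup>s)"
      using con r(2) by (auto simp: connected_conv)
    from *[OF this] show "(u, v) \<in> rtrancl_on (verts H) ((arcs_ends H)\<^sup>s)"
      using uv r(2) by auto
  qed
qed

lemma (in core_with_half_lines) core_arc_endpoints:
  assumes "e \<in> arcs G" "e \<notin> half_lines G len"
  shows "tail G e \<notin> head G ` half_lines G len" "head G e \<notin> head G ` half_lines G len"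
proof -
  interpret C: wf_digraph "compact_core G len" by (rule wf_core)
  show "tail G e \<notin> head G ` half_lines G len" "head G e \<notin> head G ` half_lines G len"
    using C.tail_in_verts[of e] C.head_in_verts[of e] assms by auto
qed

text \<open>
  The inequalities hold on graphs with a connected core, so it has to be checked that a connected
  piece stays connected when its half-lines are removed. It does, because a vertex at infinity
  is an end of nothing but its half-line: a path between core vertices can only enter a half-line
  to return at once.
\<close>

lemma (in core_with_half_lines) connected_subgraph_core_with_half_lines:
  assumes sub: "subgraph H G" and con: "Digraph_Component.connected H"
    and ne: "arcs H \<noteq> {}"
  shows "core_with_half_lines H len"
proof -
  interpret H: wf_digraph H using sub by (auto simp: subgraph_def)
  have eq: "tail H = tail G" "head H = head G"
    using sub by (auto simp: subgraph_def compatible_def)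
  have sub': "verts H \<subseteq> verts G" "arcs H \<subseteq> arcs G" using sub by (auto simp: subgraph_def)
  have hl: "half_lines H len = half_lines G len \<inter> arcs H"
    using sub' by (auto simp: half_lines_def)
  have hlG: "half_lines H len \<subseteq> arcs H" by (auto simp: half_lines_def)
  have tl: "tail G e \<in> verts H - head G ` half_lines H len" if "e \<in> half_lines H len" for e
    using tail_half_line[of e] that hl H.tail_in_verts[of e] eq by auto
  have core: "tail G e \<in> verts H - head G ` half_lines H len"
       "head G e \<in> verts H - head G ` half_lines H len" if "e \<in> arcs H" "e \<notin> half_lines H len" for e
    using core_arc_endpoints[of e] that hl H.tail_in_verts[of e] H.head_in_verts[of e] eq sub' by auto
  have wfc: "wf_digraph (compact_core H len)"
    by unfold_locales (use core in \<open>auto simp: eq\<close>)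
  \<comment> \<open>Collapse every half-line onto its starting point. This is well defined because distinct
    half-lines have distinct heads.\<close>
  define r where "r v = (if v \<in> head G ` half_lines H len
    then tail G (inv_into (half_lines H len) (head G) v) else v)" for v
  have inj: "inj_on (head G) (half_lines H len)"
    using inj_head_half_line hl by (auto intro: inj_on_subset)
  have r_head: "r (head G e) = tail G e" if "e \<in> half_lines H len" for e
    using that inj by (simp add: r_def)
  have r_id: "r v = v" if "v \<notin> head G ` half_lines H len" for v
    using that by (simp add: r_def)
  have conc: "Digraph_Component.connected (compact_core H len)"
  proof (rule connected_retract[OF con])
    show "r ` verts H \<subseteq> verts (compact_core H len)"
    proof
      fix w assume "w \<in> r ` verts H"
      then obtain v where v: "v \<in> verts H" "w = r v" by auto
      show "w \<in> verts (compact_core H len)"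
      proof (cases "v \<in> head G ` half_lines H len")
        case True
        then obtain e where "e \<in> half_lines H len" "v = head G e" by auto
        then show ?thesis using v(2) tl r_head by (simp add: eq)
      next
        case False
        then show ?thesis using v r_id by (auto simp: eq)
      qed
    qed
    show "v \<in> verts H \<and> r v = v" if "v \<in> verts (compact_core H len)" for v
      using that r_id by (auto simp: eq)
    show "r (tail H e) = r (head H e) \<or> (r (tail H e), r (head H e)) \<in> arcs_ends (compact_core H len)"
      if "e \<in> arcs H" for e
    proof (cases "e \<in> half_lines H len")
      case True
      then show ?thesis using r_head tl[OF True] r_id by (auto simp: eq)
    next
      case False
      then show ?thesis using core[OF that False] r_id that
        by (auto simp: eq arcs_ends_def arc_to_ends_def)
    qed
  qed
  show ?thesis
  proof (intro core_with_half_lines.intro core_with_half_lines_axioms.intro H.fin_digraphI)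
    show "finite (verts H)" "finite (arcs H)"
      using sub' finite_verts finite_arcs by (auto intro: finite_subset)
    show "0 < len e" if "e \<in> arcs H" for e using that sub' len_pos by auto
    show "wf_digraph (compact_core H len)" by fact
    show "Digraph_Component.connected (compact_core H len)" by fact
    show "tail H e \<in> verts (compact_core H len)" if "e \<in> half_lines H len" for e
      using tl[OF that] by (simp add: eq)
    show "inj_on (head H) (half_lines H len)" using inj by (simp add: eq)
  qed
qed

section \<open>Relabelling\<close>

text \<open>
  The constants are quantified over graphs with natural number labels. Integrals and weak
  derivatives are formed edge by edge and do not see the labels, so the inequalities transfer to
  every finite graph along an injective relabelling.
\<close>

locale relabelling = core_with_half_lines G len
  for G :: "('v, 'e) pre_digraph" and len +
  fixes fv :: "'v \<Rightarrow> 'w" and fa :: "'e \<Rightarrow> 'f"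
  assumes inj_fv: "inj_on fv (verts G)" and inj_fa: "inj_on fa (arcs G)"
begin

definition unlabel :: "'f \<Rightarrow> 'e" where
  "unlabel = inv_into (arcs G) fa"

definition iso :: "('v, 'e, 'w, 'f) digraph_isomorphism" where
  "iso = \<lparr> iso_verts = fv, iso_arcs = fa,
     iso_head = fv \<circ> head G \<circ> unlabel, iso_tail = fv \<circ> tail G \<circ> unlabel \<rparr>"

definition relabelled :: "('w, 'f) pre_digraph" where
  "relabelled = app_iso iso G"

lemma unlabel [simp]: "e \<in> arcs G \<Longrightarrow> unlabel (fa e) = e"
  by (simp add: unlabel_def inj_fa)

lemma relabelled_simps [simp]:
  "verts relabelled = fv ` verts G" "arcs relabelled = fa ` arcs G"
  "tail relabelled = fv \<circ> tail G \<circ> unlabel" "head relabelled = fv \<circ> head G \<circ> unlabel"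
  by (simp_all add: relabelled_def iso_def)

lemma half_lines_relabelled: "half_lines relabelled (len \<circ> unlabel) = fa ` half_lines G len"
  by (auto simp: half_lines_def)

lemma compact_core_relabelled:
  "compact_core relabelled (len \<circ> unlabel) = app_iso iso (compact_core G len)"
proof -
  have sub: "half_lines G len \<subseteq> arcs G" by (auto simp: half_lines_def)
  have "(fv \<circ> head G \<circ> unlabel) ` fa ` half_lines G len = fv ` head G ` half_lines G len"
    using sub by (force simp: image_image)
  moreover have "fv ` verts G - fv ` head G ` half_lines G len
      = fv ` (verts G - head G ` half_lines G len)"
    by (rule inj_on_image_set_diff[OF inj_fv, symmetric]) (use sub in auto)
  moreover have "fa ` arcs G - fa ` half_lines G len = fa ` (arcs G - half_lines G len)"
    by (rule inj_on_image_set_diff[OF inj_fa, symmetric]) (use sub in auto)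
  ultimately show ?thesis
    by (simp add: compact_core_def half_lines_relabelled app_iso_def)
       (simp add: iso_def)
qed

lemma core_with_half_lines_relabelled: "core_with_half_lines relabelled (len \<circ> unlabel)"
proof -
  have sub: "half_lines G len \<subseteq> arcs G" by (auto simp: half_lines_def)
  have iso: "digraph_isomorphism iso"
    by (auto simp: digraph_isomorphism_def iso_def inj_fv inj_fa wf_digraph_axioms)
  interpret C: wf_digraph "compact_core G len" by (rule wf_core)
  have isoC: "C.digraph_isomorphism iso"
    by (auto simp: C.digraph_isomorphism_def iso_def wf_core
        intro: inj_on_subset[OF inj_fv] inj_on_subset[OF inj_fa])
  interpret R: fin_digraph relabelled
    unfolding relabelled_def using iso by (rule fin_digraphI_app_iso)
  show ?thesis
  proof (intro core_with_half_lines.intro core_with_half_lines_axioms.intro R.fin_digraph_axioms)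
    show "0 < (len \<circ> unlabel) e" if "e \<in> arcs relabelled" for e
      using that len_pos by auto
    show "wf_digraph (compact_core relabelled (len \<circ> unlabel))"
      unfolding compact_core_relabelled using isoC by (rule C.wf_digraphI_app_iso)
    show "Digraph_Component.connected (compact_core relabelled (len \<circ> unlabel))"
      unfolding compact_core_relabelled using core_connected isoC by (rule C.connectedI_app_iso)
    show "tail relabelled e \<in> verts (compact_core relabelled (len \<circ> unlabel))"
      if "e \<in> half_lines relabelled (len \<circ> unlabel)" for e
      using that tail_half_line sub unfolding half_lines_relabelled compact_core_relabelled
      by (auto simp: iso_def subset_iff)
    show "inj_on (head relabelled) (half_lines relabelled (len \<circ> unlabel))"
    proof (rule inj_onI)
      fix x y assume *: "x \<in> half_lines relabelled (len \<circ> unlabel)"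
        "y \<in> half_lines relabelled (len \<circ> unlabel)" "head relabelled x = head relabelled y"
      then obtain a b where ab: "x = fa a" "y = fa b" "a \<in> half_lines G len" "b \<in> half_lines G len"
        by (auto simp: half_lines_relabelled)
      have "a \<in> arcs G" "b \<in> arcs G" using ab sub by auto
      then have "head G a = head G b"
        using *(3) ab inj_onD[OF inj_fv] by auto
      then show "x = y" using inj_onD[OF inj_head_half_line] ab by auto
    qed
  qed
qed

lemma edge_interval_relabelled [simp]:
  "e \<in> arcs G \<Longrightarrow> edge_interval (len \<circ> unlabel) (fa e) = edge_interval len e"
  by (simp add: edge_interval_def)

lemma H1_relabelled:
  assumes "u \<in> H1 G len"
  shows "u \<circ> unlabel \<in> H1 relabelled (len \<circ> unlabel)"
proof -
  from assms obtain c where c: "\<And>e. e \<in> arcs G \<Longrightarrow> u e 0 = c (tail G e)"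
    "\<And>e. e \<in> arcs G \<Longrightarrow> len e < \<infinity> \<Longrightarrow> u e (enn2real (len e)) = c (head G e)"
    by (auto simp: H1_def continuous_on_graph_def)
  have "\<exists>c. \<forall>e\<in>arcs relabelled. (u \<circ> unlabel) e 0 = c (tail relabelled e) \<and>
      ((len \<circ> unlabel) e < \<infinity> \<longrightarrow>
        (u \<circ> unlabel) e (enn2real ((len \<circ> unlabel) e)) = c (head relabelled e))"
    by (rule exI[of _ "c \<circ> inv_into (verts G) fv"]) (use inj_fv c in auto)
  then show ?thesis
    using assms by (auto simp: H1_def continuous_on_graph_def)
qed

lemma Lq_norm_relabelled:
  "Lq_norm relabelled (len \<circ> unlabel) q (u \<circ> unlabel) = Lq_norm G len q u"
  unfolding Lq_norm_def using inj_fa by (simp add: sum.reindex cong: sum.cong)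

lemma Linf_norm_relabelled:
  "Linf_norm relabelled (len \<circ> unlabel) (u \<circ> unlabel) = Linf_norm G len u"
  unfolding Linf_norm_def by (simp add: image_image cong: image_cong)

lemma graph_deriv_relabelled:
  "Lq_norm relabelled (len \<circ> unlabel) q (graph_deriv (len \<circ> unlabel) (u \<circ> unlabel))
     = Lq_norm G len q (graph_deriv len u)"
  unfolding Lq_norm_def graph_deriv_def using inj_fa by (simp add: sum.reindex cong: sum.cong)

end

lemma (in core_with_half_lines) obtain_nat_relabelling:
  obtains fv :: "_ \<Rightarrow> nat" and fa :: "_ \<Rightarrow> nat" where "relabelling G len fv fa"
proof -
  obtain fv :: "_ \<Rightarrow> nat" where "inj_on fv (verts G)"
    using finite_imp_inj_to_nat_seg[OF finite_verts] by blast
  moreover obtain fa :: "_ \<Rightarrow> nat" where "inj_on fa (arcs G)"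
    using finite_imp_inj_to_nat_seg[OF finite_arcs] by blast
  ultimately show ?thesis by (intro that[of fv fa]) unfold_locales
qed

lemma GN_const_LpD:
  assumes "GN_const_Lp p C" "core_with_half_lines G len" "half_lines G len \<noteq> {}" "u \<in> H1 G len"
  shows "Lq_norm G len p u powr p
     \<le> C * Lq_norm G len 2 u powr (p / 2 + 1) * Lq_norm G len 2 (graph_deriv len u) powr (p / 2 - 1)"
proof -
  interpret core_with_half_lines G len by fact
  obtain fv fa :: "_ \<Rightarrow> nat" where "relabelling G len fv fa"
    by (rule obtain_nat_relabelling)
  then interpret relabelling G len fv fa .
  have "half_lines relabelled (len \<circ> unlabel) \<noteq> {}"
    using assms by (simp add: half_lines_relabelled)
  then have "Lq_norm relabelled (len \<circ> unlabel) p (u \<circ> unlabel) powr p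
     \<le> C * Lq_norm relabelled (len \<circ> unlabel) 2 (u \<circ> unlabel) powr (p / 2 + 1)
         * Lq_norm relabelled (len \<circ> unlabel) 2 (graph_deriv (len \<circ> unlabel) (u \<circ> unlabel)) powr (p / 2 - 1)"
    using assms(1) core_with_half_lines_relabelled H1_relabelled[OF assms(4)]
    unfolding GN_const_Lp_def by blast
  then show ?thesis by (simp only: Lq_norm_relabelled graph_deriv_relabelled)
qed

lemma GN_const_LinfD:
  assumes "GN_const_Linf C" "core_with_half_lines G len" "half_lines G len \<noteq> {}" "u \<in> H1 G len"
  shows "Linf_norm G len u
     \<le> ennreal (C * Lq_norm G len 2 u powr (1 / 2) * Lq_norm G len 2 (graph_deriv len u) powr (1 / 2))"
proof -
  interpret core_with_half_lines G len by fact
  obtain fv fa :: "_ \<Rightarrow> nat" where "relabelling G len fv fa"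
    by (rule obtain_nat_relabelling)
  then interpret relabelling G len fv fa .
  have "half_lines relabelled (len \<circ> unlabel) \<noteq> {}"
    using assms by (simp add: half_lines_relabelled)
  then have "Linf_norm relabelled (len \<circ> unlabel) (u \<circ> unlabel)
     \<le> ennreal (C * Lq_norm relabelled (len \<circ> unlabel) 2 (u \<circ> unlabel) powr (1 / 2)
         * Lq_norm relabelled (len \<circ> unlabel) 2 (graph_deriv (len \<circ> unlabel) (u \<circ> unlabel)) powr (1 / 2))"
    using assms(1) core_with_half_lines_relabelled H1_relabelled[OF assms(4)]
    unfolding GN_const_Linf_def by blast
  then show ?thesis by (simp only: Linf_norm_relabelled Lq_norm_relabelled graph_deriv_relabelled)
qed

section \<open>Uniqueness of weak derivatives\<close>

text \<open>
  The open intervals form an intersection-stable generator of the Borel sets, and the sets over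
  which \<open>k\<close> has integral zero form a Dynkin system.
\<close>

lemma AE_zero_if_interval_integrals_zero:
  fixes k :: "real \<Rightarrow> real"
  assumes k: "integrable lborel k"
    and z: "\<And>c d. (LINT x:{c<..<d}|lborel. k x) = 0"
  shows "AE x in lborel. k x = 0"
proof (rule sigma_finite_measure.density_zero[OF sigma_finite_lborel k])
  fix A :: "real set" assume A: "A \<in> sets lborel"
  have int: "set_integrable lborel S k" if "S \<in> sets borel" for S
    using k that integrable_mult_indicator[of S lborel k] by (simp add: set_integrable_def)
  have U: "(LINT x:UNIV|lborel. k x) = 0"
  proof -
    have un: "(\<Union>n. {- real n<..<real n}) = (UNIV :: real set)"
    proof -
      have "\<exists>n. x \<in> {- real n<..<real n}" for x :: real
        using reals_Archimedean2[of "\<bar>x\<bar>"] by (auto simp: abs_less_iff minus_less_iff)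
      then show ?thesis by auto
    qed
    have "(\<lambda>n. LINT x:{- real n<..<real n}|lborel. k x) \<longlonglongrightarrow> (LINT x:(\<Union>n. {- real n<..<real n})|lborel. k x)"
      by (rule set_integral_cont_up) (auto simp: incseq_def un intro!: int)
    then show ?thesis by (simp add: z un LIMSEQ_const_iff)
  qed
  have stable: "Int_stable (range (\<lambda>(a::real, b). {a<..<b}))"
    by (rule Int_stableI) (auto simp: image_iff, blast)
  have gen: "sets borel = sigma_sets UNIV (range (\<lambda>(a::real, b). {a<..<b}))"
    by (subst borel_eq_box) (simp add: sets_measure_of box_real case_prod_beta')
  have sub: "range (\<lambda>(a::real, b). {a<..<b}) \<subseteq> Pow UNIV" by simp
  have "A \<in> sigma_sets UNIV (range (\<lambda>(a::real, b). {a<..<b}))"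
    using A by (simp add: gen)
  with stable sub show "(LINT x:A|lborel. k x) = 0"
  proof (induction rule: sigma_sets_induct_disjoint)
    case (basic A)
    then show ?case using z by auto
  next
    case empty
    then show ?case by (simp add: set_lebesgue_integral_def)
  next
    case (compl A)
    then have A: "A \<in> sets borel" by (simp add: gen)
    have "(LINT x:A \<union> (UNIV - A)|lborel. k x) = (LINT x:A|lborel. k x) + (LINT x:UNIV - A|lborel. k x)"
      using A by (intro set_integral_Un int) auto
    then show ?case using compl U by simp
  next
    case (union A)
    have A: "A i \<in> sets borel" for i using union(2) by (auto simp: gen)
    have "(LINT x:(\<Union>i. A i)|lborel. k x) = (\<Sum>i. LINT x:A i|lborel. k x)"
      using A union(1) by (intro lebesgue_integral_countable_add int) (auto simp: disjoint_family_on_def)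
    then show ?case using union by simp
  qed
qed

text \<open>
  By \<open>\<bar>g\<bar> \<le> 1 + g\<^sup>2\<close>, as constants are integrable over bounded intervals.
\<close>

lemma L2_on_bounded_integrable:
  assumes g: "L2_on I g" and sub: "{c..d} \<subseteq> I"
  shows "set_integrable lborel {c..d} g"
  unfolding set_integrable_def
proof (rule Bochner_Integration.integrable_bound)
  have "set_integrable lborel {c..d} (\<lambda>x. (g x)\<^sup>2)"
    using g sub by (auto simp: L2_on_def intro: set_integrable_subset)
  then have "set_integrable lborel {c..d} (\<lambda>x. 1 + (g x)\<^sup>2)"
    by (intro set_integral_add(1)) (simp_all add: borel_integrable_atLeastAtMost')
  then show "integrable lborel (\<lambda>x. indicat_real {c..d} x *\<^sub>R (1 + (g x)\<^sup>2))"
    by (simp add: set_integrable_def)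
  have "(\<lambda>x. indicat_real I x *\<^sub>R g x) \<in> borel_measurable lborel"
    using g by (simp add: L2_on_def set_borel_measurable_def)
  then have "(\<lambda>x. indicat_real {c..d} x * (indicat_real I x *\<^sub>R g x)) \<in> borel_measurable lborel"
    by measurable
  also have "(\<lambda>x. indicat_real {c..d} x * (indicat_real I x *\<^sub>R g x)) = (\<lambda>x. indicat_real {c..d} x *\<^sub>R g x)"
    using sub by (auto simp: indicator_def fun_eq_iff)
  finally show "(\<lambda>x. indicat_real {c..d} x *\<^sub>R g x) \<in> borel_measurable lborel" .
  have "\<bar>t\<bar> \<le> 1 + t\<^sup>2" for t :: real
  proof -
    have "0 \<le> (\<bar>t\<bar> - 1)\<^sup>2 + 1 + t\<^sup>2" by simp
    then show ?thesis by (simp add: power2_eq_square algebra_simps)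
  qed
  then show "AE x in lborel. norm (indicat_real {c..d} x *\<^sub>R g x) \<le> norm (indicat_real {c..d} x *\<^sub>R (1 + (g x)\<^sup>2))"
    by (auto simp: indicator_def intro!: AE_I2 order_trans[OF _ abs_ge_self])
qed

lemma has_real_derivative_max_0_square:
  "((\<lambda>y. (max 0 y)\<^sup>2) has_real_derivative 2 * max 0 y) (at y)"
proof -
  consider "y > 0" | "y < 0" | "y = 0" by linarith
  then show ?thesis
  proof cases
    case 1
    have "((\<lambda>y. y\<^sup>2) has_real_derivative 2 * y) (at y)"
      by (auto intro!: derivative_eq_intros)
    then have "((\<lambda>y. (max 0 y)\<^sup>2) has_real_derivative 2 * y) (at y)"
      by (rule has_field_derivative_transform_within_open[of _ _ _ "{0<..}"]) (use 1 in auto)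
    then show ?thesis using 1 by simp
  next
    case 2
    have "((\<lambda>y. 0) has_real_derivative 0) (at y)"
      by (auto intro!: derivative_eq_intros)
    then have "((\<lambda>y. (max 0 y)\<^sup>2) has_real_derivative 0) (at y)"
      by (rule has_field_derivative_transform_within_open[of _ _ _ "{..<0}"]) (use 2 in auto)
    then show ?thesis using 2 by simp
  next
    case 3
    have "((\<lambda>h. ((max 0 (0 + h))\<^sup>2 - (max 0 0)\<^sup>2) / h) \<longlongrightarrow> 0) (at (0::real))"
    proof (rule tendsto_sandwich[of "\<lambda>h. - \<bar>h\<bar>" _ _ "\<lambda>h. \<bar>h\<bar>"])
      show "\<forall>\<^sub>F h in at 0. - \<bar>h\<bar> \<le> ((max 0 (0 + h))\<^sup>2 - (max 0 0)\<^sup>2) / (h::real)"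
        by (auto simp: max_def power2_eq_square divide_simps intro!: eventuallyI)
      show "\<forall>\<^sub>F h in at 0. ((max 0 (0 + h))\<^sup>2 - (max 0 0)\<^sup>2) / h \<le> \<bar>h::real\<bar>"
        by (auto simp: max_def power2_eq_square divide_simps intro!: eventuallyI)
    qed (auto intro!: tendsto_eq_intros)
    then show ?thesis using 3 by (simp add: DERIV_def)
  qed
qed

text \<open>
  Test functions that increase to the indicator of \<open>{a<..<b}\<close> as \<open>n\<close> grows. The positive part
  is squared to make them continuously differentiable across \<open>a\<close> and \<open>b\<close>.
\<close>

definition plateau :: "real \<Rightarrow> real \<Rightarrow> nat \<Rightarrow> real \<Rightarrow> real" where
  "plateau a b n x = (let s = (max 0 ((x - a) * (b - x)))\<^sup>2 in real n * s / (1 + real n * s))"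

lemma plateau_bounds: "0 \<le> plateau a b n x" "plateau a b n x \<le> 1"
proof -
  have "0 < 1 + real n * (max 0 ((x - a) * (b - x)))\<^sup>2"
    by (smt (verit) mult_nonneg_nonneg of_nat_0_le_iff zero_le_power2)
  then show "0 \<le> plateau a b n x" "plateau a b n x \<le> 1"
    by (auto simp: plateau_def Let_def)
qed

lemma plateau_outside: "a \<le> b \<Longrightarrow> x \<notin> {a<..<b} \<Longrightarrow> plateau a b n x = 0"
proof -
  assume "a \<le> b" "x \<notin> {a<..<b}"
  then have "(x - a) * (b - x) \<le> 0" by (auto simp: mult_le_0_iff)
  then show ?thesis by (simp add: plateau_def)
qed

lemma plateau_tendsto:
  assumes "a \<le> b"
  shows "(\<lambda>n. plateau a b n x) \<longlonglongrightarrow> indicat_real {a<..<b} x"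
proof (cases "x \<in> {a<..<b}")
  case True
  define s where "s = (max 0 ((x - a) * (b - x)))\<^sup>2"
  have s: "s > 0" using True by (simp add: s_def)
  have "(\<lambda>n. real n * s / (1 + real n * s)) \<longlonglongrightarrow> 1"
    using s by real_asymp
  then show ?thesis using True by (simp add: plateau_def s_def Let_def)
next
  case False
  then show ?thesis using assms by (simp add: plateau_outside)
qed

lemma plateau_test_function:
  assumes "a \<le> b" "{a..b} \<subseteq> S"
  shows "test_function S (plateau a b n)"
proof -
  define s where "s x = (max 0 ((x - a) * (b - x)))\<^sup>2" for x
  define D where "D x = real n * (2 * max 0 ((x - a) * (b - x)) * (a + b - 2 * x)) / (1 + real n * s x)\<^sup>2" for x
  have pos: "1 + real n * s x \<noteq> 0" for x
    by (smt (verit) mult_nonneg_nonneg of_nat_0_le_iff zero_le_power2 s_def)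
  have ds: "(s has_real_derivative 2 * max 0 ((x - a) * (b - x)) * (a + b - 2 * x)) (at x)" for x
  proof -
    have "((\<lambda>x. (x - a) * (b - x)) has_real_derivative (a + b - 2 * x)) (at x)"
      by (auto intro!: derivative_eq_intros)
    from DERIV_chain2[OF has_real_derivative_max_0_square this] show ?thesis by (simp add: s_def[abs_def])
  qed
  have eq: "plateau a b n = (\<lambda>x. real n * s x / (1 + real n * s x))"
    by (simp add: plateau_def s_def fun_eq_iff Let_def)
  have der: "(plateau a b n has_real_derivative D x) (at x)" for x
    unfolding eq using pos[of x]
    by (auto intro!: derivative_eq_intros ds simp: D_def field_simps power2_eq_square)
  have "continuous_on UNIV D"
    unfolding D_def s_def using pos[unfolded s_def] by (intro continuous_intros) auto
  then have C1: "plateau a b n C1_differentiable_on UNIV"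
    using der unfolding C1_differentiable_on_def
    by (auto simp: has_real_derivative_iff_has_vector_derivative)
  have cl: "closure {x. plateau a b n x \<noteq> 0} \<subseteq> {a..b}"
  proof (rule closure_minimal)
    show "{x. plateau a b n x \<noteq> 0} \<subseteq> {a..b}"
    proof
      fix x assume "x \<in> {x. plateau a b n x \<noteq> 0}"
      then have "x \<in> {a<..<b}" using plateau_outside[OF assms(1), of x n] by auto
      then show "x \<in> {a..b}" by simp
    qed
  qed simp
  then have "compact (closure {x. plateau a b n x \<noteq> 0})"
    by (meson bounded_closed_interval bounded_subset closed_closure compact_eq_bounded_closed)
  then show ?thesis using C1 cl assms(2) by (auto simp: test_function_def)
qed

text \<open>
  The left-hand side depends on \<open>f\<close> alone, so the integrals of a weak derivative over compactly
  contained intervals are determined by \<open>f\<close>.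
\<close>

lemma weak_deriv_interval_integral:
  assumes g: "has_weak_deriv I f g" and ab: "a \<le> b" "{a..b} \<subseteq> interior I"
  shows "(\<lambda>n. - (LINT x:I|lborel. f x * deriv (plateau a b n) x)) \<longlonglongrightarrow> (LINT x:{a<..<b}|lborel. g x)"
proof -
  have sub: "{a..b} \<subseteq> I" using ab interior_subset by blast
  have g2: "L2_on I g" using g by (simp add: has_weak_deriv_def)
  have int: "set_integrable lborel {a..b} g" by (rule L2_on_bounded_integrable[OF g2 sub])
  have eq: "- (LINT x:I|lborel. f x * deriv (plateau a b n) x) = (LINT x|lborel. indicat_real {a..b} x * g x * plateau a b n x)" for n
  proof -
    have "- (LINT x:I|lborel. f x * deriv (plateau a b n) x) = (LINT x:I|lborel. g x * plateau a b n x)"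
      using g plateau_test_function[OF ab, of n] by (auto simp: has_weak_deriv_def)
    also have "\<dots> = (LINT x|lborel. indicat_real {a..b} x * g x * plateau a b n x)"
      unfolding set_lebesgue_integral_def
      by (rule Bochner_Integration.integral_cong) (use sub plateau_outside[OF ab(1)] in \<open>auto simp: indicator_def\<close>)
    finally show ?thesis .
  qed
  have meas: "plateau a b n \<in> borel_measurable borel" for n
    by (simp add: plateau_def[abs_def] Let_def)
  have "(\<lambda>n. LINT x|lborel. indicat_real {a..b} x * g x * plateau a b n x) \<longlonglongrightarrow> (LINT x|lborel. indicat_real {a<..<b} x * g x)"
  proof (rule integral_dominated_convergence)
    have m: "(\<lambda>x. indicat_real {a..b} x * g x) \<in> borel_measurable lborel"
      using int by (auto simp: set_integrable_def)
    show "(\<lambda>x. indicat_real {a..b} x * g x * plateau a b n x) \<in> borel_measurable lborel" for n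
      using m meas[of n] by measurable
    have "(\<lambda>x. indicat_real {a<..<b} x * (indicat_real {a..b} x * g x)) \<in> borel_measurable lborel"
      using m by measurable
    also have "(\<lambda>x. indicat_real {a<..<b} x * (indicat_real {a..b} x * g x)) = (\<lambda>x. indicat_real {a<..<b} x * g x)"
      by (auto simp: indicator_def)
    finally show "(\<lambda>x. indicat_real {a<..<b} x * g x) \<in> borel_measurable lborel" .
    show "integrable lborel (\<lambda>x. \<bar>indicat_real {a..b} x * g x\<bar>)"
      using int by (auto simp: set_integrable_def)
    show "AE x in lborel. norm (indicat_real {a..b} x * g x * plateau a b n x) \<le> \<bar>indicat_real {a..b} x * g x\<bar>" for n
      using plateau_bounds[of a b n] by (intro AE_I2) (auto simp: abs_mult intro!: mult_left_le)
    have "(\<lambda>n. indicat_real {a..b} x * g x * plateau a b n x) \<longlonglongrightarrow> indicat_real {a<..<b} x * g x" for x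
    proof -
      have "(\<lambda>n. indicat_real {a..b} x * g x * plateau a b n x) \<longlonglongrightarrow> indicat_real {a..b} x * g x * indicat_real {a<..<b} x"
        by (intro tendsto_intros plateau_tendsto ab)
      also have "indicat_real {a..b} x * g x * indicat_real {a<..<b} x = indicat_real {a<..<b} x * g x"
        by (auto simp: indicator_def)
      finally show ?thesis .
    qed
    then show "AE x in lborel. (\<lambda>n. indicat_real {a..b} x * g x * plateau a b n x) \<longlonglongrightarrow> indicat_real {a<..<b} x * g x"
      by simp
  qed
  then have "(\<lambda>n. - (LINT x:I|lborel. f x * deriv (plateau a b n) x)) \<longlonglongrightarrow> (LINT x|lborel. indicat_real {a<..<b} x * g x)"
    by (simp only: eq)
  then show ?thesis by (simp add: set_lebesgue_integral_def)
qed

lemma weak_deriv_unique_on_interval: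
  assumes g: "has_weak_deriv I f g" and g': "has_weak_deriv I f g'" and ab: "a \<le> b" "{a..b} \<subseteq> interior I"
  shows "AE x in lborel. x \<in> {a<..<b} \<longrightarrow> g x = g' x"
proof -
  define k where "k x = indicat_real {a<..<b} x * (g x - g' x)" for x
  have sub: "{a..b} \<subseteq> I" using ab interior_subset by blast
  have int: "set_integrable lborel {c<..<d} g" "set_integrable lborel {c<..<d} g'"
    if "a \<le> c" "d \<le> b" for c d
    using L2_on_bounded_integrable[of I g a b] L2_on_bounded_integrable[of I g' a b] sub g g' that
    by (auto simp: has_weak_deriv_def intro: set_integrable_subset)
  have "AE x in lborel. k x = 0"
  proof (rule AE_zero_if_interval_integrals_zero)
    show "integrable lborel k"
      using set_integral_diff(1)[OF int[of a b]] by (simp add: set_integrable_def k_def[abs_def])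
    fix c d :: real
    define c' d' where "c' = max a c" and "d' = min b d"
    have "(LINT x:{c<..<d}|lborel. k x) = (LINT x:{c'<..<d'}|lborel. g x - g' x)"
      unfolding set_lebesgue_integral_def k_def c'_def d'_def
      by (rule Bochner_Integration.integral_cong) (auto simp: indicator_def)
    also have "\<dots> = (LINT x:{c'<..<d'}|lborel. g x) - (LINT x:{c'<..<d'}|lborel. g' x)"
      by (intro set_integral_diff int) (auto simp: c'_def d'_def)
    also have "\<dots> = 0"
    proof (cases "c' \<le> d'")
      case True
      have "{c'..d'} \<subseteq> interior I" using ab(2) by (auto simp: c'_def d'_def)
      from LIMSEQ_unique[OF weak_deriv_interval_integral[OF g True this] weak_deriv_interval_integral[OF g' True this]]
      show ?thesis by simp
    next
      case False
      then show ?thesis by (simp add: set_lebesgue_integral_def)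
    qed
    finally show "(LINT x:{c<..<d}|lborel. k x) = 0" .
  qed
  then show ?thesis by eventually_elim (auto simp: k_def)
qed

text \<open>
  By Lindelof's theorem the interior is a countable union of compactly contained open intervals,
  so the null sets of the previous lemma add up to a null set.
\<close>

lemma weak_deriv_unique:
  assumes g: "has_weak_deriv I f g" and g': "has_weak_deriv I f g'"
  shows "AE x in lborel. x \<in> interior I \<longrightarrow> g x = g' x"
proof -
  define F where "F = {{a<..<b} | a b::real. a \<le> b \<and> {a..b} \<subseteq> interior I}"
  have "\<And>S. S \<in> F \<Longrightarrow> open S" by (auto simp: F_def)
  then obtain F' where F': "F' \<subseteq> F" "countable F'" "\<Union>F' = \<Union>F"
    using Lindelof[of F] by auto
  have "\<forall>S\<in>F'. AE x in lborel. x \<in> S \<longrightarrow> g x = g' x"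
  proof
    fix S assume "S \<in> F'"
    then obtain a b where "S = {a<..<b}" "a \<le> b" "{a..b} \<subseteq> interior I"
      using F'(1) unfolding F_def by blast
    then show "AE x in lborel. x \<in> S \<longrightarrow> g x = g' x"
      using weak_deriv_unique_on_interval[OF g g'] by simp
  qed
  then have "AE x in lborel. \<forall>S\<in>F'. x \<in> S \<longrightarrow> g x = g' x"
    by (rule AE_ball_countable[OF F'(2), THEN iffD2])
  moreover have "x \<in> \<Union>F" if x: "x \<in> interior I" for x
  proof -
    obtain e where e: "e > 0" "cball x e \<subseteq> interior I"
      using open_contains_cball[of "interior I"] x by auto
    then have "{x - e<..<x + e} \<in> F"
      unfolding F_def mem_Collect_eq
      by (intro exI[of _ "x - e"] exI[of _ "x + e"]) (simp add: cball_eq_atLeastAtMost)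
    moreover have "x \<in> {x - e<..<x + e}" using e by auto
    ultimately show ?thesis by blast
  qed
  ultimately show ?thesis using F'(3) by (auto elim!: eventually_mono)
qed

lemma edge_interval_cases:
  obtains l where "0 \<le> l" "len e = ennreal l" "edge_interval len e = {0..l}"
  | "len e = \<infinity>" "edge_interval len e = {0..}"
proof (cases "len e")
  case (real l)
  then have "edge_interval len e = {0..l}" by (auto simp: edge_interval_def)
  with real that(1) show ?thesis by blast
next
  case top
  then have "edge_interval len e = {0..}" by (auto simp: edge_interval_def)
  with top that(2) show ?thesis by simp
qed

lemma edge_interval_borel [measurable, simp]: "edge_interval len e \<in> sets borel"
  by (cases rule: edge_interval_cases[of len e]) auto

lemma AE_edge_interval_interior:
  "AE x in lborel. x \<in> edge_interval len e \<longrightarrow> x \<in> interior (edge_interval len e)"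
proof -
  have "\<exists>l. edge_interval len e - interior (edge_interval len e) \<subseteq> {0, l}"
    by (cases rule: edge_interval_cases[of len e]) auto
  then obtain l where l: "edge_interval len e - interior (edge_interval len e) \<subseteq> {0, l}" ..
  have "AE x in lborel. x \<noteq> 0" "AE x in lborel. x \<noteq> l"
    by (rule AE_lborel_singleton)+
  then show ?thesis by eventually_elim (use l in auto)
qed

text \<open>
  The chosen representative \<^const>\<open>weak_deriv\<close> may be replaced by any weak derivative that is
  known explicitly: they agree off a null set in the interior, and an edge has at most two
  boundary points.
\<close>

lemma weak_deriv_L2:
  assumes g: "has_weak_deriv (edge_interval len e) f g"
  shows "(LINT x:edge_interval len e|lborel. \<bar>weak_deriv (edge_interval len e) f x\<bar> powr 2)
    = (LINT x:edge_interval len e|lborel. \<bar>g x\<bar> powr 2)"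
proof -
  let ?I = "edge_interval len e" and ?w = "weak_deriv (edge_interval len e) f"
  have w: "has_weak_deriv ?I f ?w"
    unfolding weak_deriv_def by (rule someI[of _ g]) (rule g)
  have meas: "(\<lambda>x. indicat_real ?I x *\<^sub>R \<bar>h x\<bar> powr 2) \<in> borel_measurable lborel"
    if "has_weak_deriv ?I f h" for h
  proof -
    have "(\<lambda>x. indicat_real ?I x *\<^sub>R h x) \<in> borel_measurable lborel"
      using that by (simp add: has_weak_deriv_def L2_on_def set_borel_measurable_def)
    then have "(\<lambda>x. \<bar>indicat_real ?I x *\<^sub>R h x\<bar> powr 2) \<in> borel_measurable lborel"
      by measurable
    also have "(\<lambda>x. \<bar>indicat_real ?I x *\<^sub>R h x\<bar> powr 2) = (\<lambda>x. indicat_real ?I x *\<^sub>R \<bar>h x\<bar> powr 2)"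
      by (auto simp: indicator_def)
    finally show ?thesis .
  qed
  have "AE x in lborel. indicat_real ?I x *\<^sub>R \<bar>?w x\<bar> powr 2 = indicat_real ?I x *\<^sub>R \<bar>g x\<bar> powr 2"
    using weak_deriv_unique[OF w g] AE_edge_interval_interior[of len e]
    by eventually_elim (auto simp: indicator_def)
  then show ?thesis unfolding set_lebesgue_integral_def
    by (intro integral_cong_AE meas w g)
qed

section \<open>Low-energy functions on a half-line\<close>

text \<open>
  A parabolic arc over \<open>{0..r}\<close>, continued by zero on the half-line.
\<close>

definition hump :: "real \<Rightarrow> real \<Rightarrow> real" where
  "hump r x = max 0 (x * (r - x))"

text \<open>
  The weak derivative of \<^const>\<open>hump\<close>.
\<close>

definition hump' :: "real \<Rightarrow> real \<Rightarrow> real" where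
  "hump' r x = indicat_real {0..r} x * (r - 2 * x)"

lemma hump_eq: "0 \<le> x \<Longrightarrow> hump r x = indicat_real {0..r} x * (x * (r - x))"
  by (auto simp: hump_def indicator_def max_def mult_le_0_iff zero_le_mult_iff)

lemma indicator_hump: "indicat_real {0..} x * hump r x = x * (r - x) * indicat_real {0..r} x"
  by (cases "0 \<le> x") (auto simp: hump_eq indicator_def)

lemma has_weak_deriv_zero: "has_weak_deriv I (\<lambda>_. 0) (\<lambda>_. 0)"
  by (simp add: has_weak_deriv_def L2_on_def set_borel_measurable_def set_integrable_def
      set_lebesgue_integral_def)

lemma L2_on_zero: "L2_on I (\<lambda>_. 0)"
  by (simp add: L2_on_def set_borel_measurable_def set_integrable_def)

lemma L2_on_polynomial_cutoff:
  fixes f q :: "real \<Rightarrow> real"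
  assumes f: "\<And>x. indicat_real {0..} x * f x = q x * indicat_real {0..r} x"
    and q: "\<And>x. isCont q x"
  shows "L2_on {0..} f"
proof -
  have "q \<in> borel_measurable borel"
    using q by (intro borel_measurable_continuous_onI continuous_at_imp_continuous_on) auto
  then have "set_borel_measurable lborel {0..} f"
    by (simp add: set_borel_measurable_def f)
  moreover have "set_integrable lborel {0..} (\<lambda>x. (f x)\<^sup>2)"
  proof -
    have "integrable lborel (\<lambda>x. (q x)\<^sup>2 * indicat_real {0..r} x)"
      by (rule borel_integrable_atLeastAtMost) (intro continuous_intros q)
    also have "(\<lambda>x. (q x)\<^sup>2 * indicat_real {0..r} x) = (\<lambda>x. (q x * indicat_real {0..r} x)\<^sup>2)"
      by (auto simp: indicator_def)
    also have "\<dots> = (\<lambda>x. (indicat_real {0..} x * f x)\<^sup>2)"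
      by (simp only: f)
    also have "\<dots> = (\<lambda>x. indicat_real {0..} x *\<^sub>R (f x)\<^sup>2)"
      by (auto simp: indicator_def)
    finally show ?thesis by (simp add: set_integrable_def)
  qed
  ultimately show ?thesis by (simp add: L2_on_def)
qed

lemma indicator_cutoff_eq:
  "indicat_real {0..} x * (c * hump r x) = c * x * (r - x) * indicat_real {0..r} x"
  "indicat_real {0..} x * (c * hump' r x) = c * (r - 2 * x) * indicat_real {0..r} x"
  using indicator_hump[of x r] by (auto simp: hump'_def indicator_def)

lemma L2_on_hump: "L2_on {0..} (\<lambda>x. c * hump r x)"
  by (rule L2_on_polynomial_cutoff[OF indicator_cutoff_eq(1)]) (intro continuous_intros)

lemma L2_on_hump': "L2_on {0..} (\<lambda>x. c * hump' r x)"
  by (rule L2_on_polynomial_cutoff[OF indicator_cutoff_eq(2)]) (intro continuous_intros)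

text \<open>
  The arc vanishes at \<open>0\<close> and at \<open>r\<close>, so integration by parts on \<open>{0..r}\<close> produces no boundary
  terms.
\<close>

lemma has_weak_deriv_hump:
  assumes r: "0 < r"
  shows "has_weak_deriv {0..} (\<lambda>x. c * hump r x) (\<lambda>x. c * hump' r x)"
  unfolding has_weak_deriv_def
proof (intro conjI allI impI)
  show "L2_on {0..} (\<lambda>x. c * hump' r x)" by (rule L2_on_hump')
  fix \<phi> assume "test_function (interior {0..}) \<phi>"
  then obtain D where D: "\<And>x. (\<phi> has_real_derivative D x) (at x)" "continuous_on UNIV D"
    by (auto simp: test_function_def C1_differentiable_on_def has_real_derivative_iff_has_vector_derivative)
  have deriv: "deriv \<phi> = D" using D(1) by (auto simp: DERIV_imp_deriv)
  have "(LINT x:{0..}|lborel. c * hump r x * deriv \<phi> x)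
      = (\<integral>x. (c * x * (r - x)) * D x * indicat_real {0..r} x \<partial>lborel)"
    unfolding set_lebesgue_integral_def deriv
    by (rule Bochner_Integration.integral_cong[OF refl])
       (metis (no_types, opaque_lifting) indicator_cutoff_eq(1) mult.assoc mult.commute real_scaleR_def)
  also have "\<dots> = (c * r * (r - r)) * \<phi> r - (c * 0 * (r - 0)) * \<phi> 0
      - (\<integral>x. (c * (r - 2 * x)) * \<phi> x * indicat_real {0..r} x \<partial>lborel)"
  proof (rule integral_by_parts)
    show "0 \<le> r" using r by simp
    show "isCont D x" for x
      using D(2) by (simp add: continuous_on_eq_continuous_at)
    show "((\<lambda>x. c * x * (r - x)) has_real_derivative c * (r - 2 * x)) (at x)" for x
      by (auto intro!: derivative_eq_intros simp: algebra_simps)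
  qed (auto intro!: continuous_intros D)
  also have "(\<integral>x. (c * (r - 2 * x)) * \<phi> x * indicat_real {0..r} x \<partial>lborel)
      = (LINT x:{0..}|lborel. c * hump' r x * \<phi> x)"
    unfolding set_lebesgue_integral_def
    by (rule Bochner_Integration.integral_cong[OF refl])
       (metis (no_types, opaque_lifting) indicator_cutoff_eq(2) mult.assoc mult.commute real_scaleR_def)
  finally show "(LINT x:{0..}|lborel. c * hump r x * deriv \<phi> x) = - (LINT x:{0..}|lborel. c * hump' r x * \<phi> x)"
    by simp
qed

lemma cutoff_square_integral:
  assumes f: "\<And>x. indicat_real {0..} x * f x = q x * indicat_real {0..r} x"
    and r: "0 \<le> r" and F: "\<And>x. (F has_real_derivative (q x)\<^sup>2) (at x)" and q: "\<And>x. isCont q x"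
  shows "(LINT x:{0..}|lborel. \<bar>f x\<bar> powr 2) = F r - F 0"
proof -
  have eq: "indicat_real {0..} x *\<^sub>R \<bar>f x\<bar> powr 2 = (q x)\<^sup>2 * indicat_real {0..r} x" for x
  proof -
    have "indicat_real {0..} x *\<^sub>R \<bar>f x\<bar> powr 2 = (indicat_real {0..} x * f x)\<^sup>2"
      by (auto simp: indicator_def powr_numeral)
    also have "\<dots> = (q x)\<^sup>2 * indicat_real {0..r} x"
      unfolding f by (auto simp: indicator_def)
    finally show ?thesis .
  qed
  show ?thesis unfolding set_lebesgue_integral_def eq
    by (rule integral_FTC_Icc_real) (use r F in \<open>auto intro!: continuous_intros q\<close>)
qed

lemma hump_square_integral:
  assumes "0 < r"
  shows "(LINT x:{0..}|lborel. \<bar>c * hump r x\<bar> powr 2) = c\<^sup>2 * r ^ 5 / 30"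
    and "(LINT x:{0..}|lborel. \<bar>c * hump' r x\<bar> powr 2) = c\<^sup>2 * r ^ 3 / 3"
proof -
  have "(LINT x:{0..}|lborel. \<bar>c * hump r x\<bar> powr 2)
      = c\<^sup>2 * (r\<^sup>2 * r ^ 3 / 3 - r * r ^ 4 / 2 + r ^ 5 / 5) - c\<^sup>2 * (r\<^sup>2 * 0 ^ 3 / 3 - r * 0 ^ 4 / 2 + 0 ^ 5 / 5)"
    by (rule cutoff_square_integral[OF indicator_cutoff_eq(1)])
       (use assms in \<open>auto intro!: derivative_eq_intros continuous_intros
          simp: algebra_simps power2_eq_square power3_eq_cube power4_eq_xxxx\<close>)
  then show "(LINT x:{0..}|lborel. \<bar>c * hump r x\<bar> powr 2) = c\<^sup>2 * r ^ 5 / 30"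
    by (simp add: algebra_simps eval_nat_numeral)
  have "(LINT x:{0..}|lborel. \<bar>c * hump' r x\<bar> powr 2)
      = c\<^sup>2 * (r\<^sup>2 * r - 2 * r * r\<^sup>2 + 4 * r ^ 3 / 3) - c\<^sup>2 * (r\<^sup>2 * 0 - 2 * r * 0\<^sup>2 + 4 * 0 ^ 3 / 3)"
    by (rule cutoff_square_integral[OF indicator_cutoff_eq(2)])
       (use assms in \<open>auto intro!: derivative_eq_intros continuous_intros
          simp: algebra_simps power2_eq_square power3_eq_cube\<close>)
  then show "(LINT x:{0..}|lborel. \<bar>c * hump' r x\<bar> powr 2) = c\<^sup>2 * r ^ 3 / 3"
    by (simp add: algebra_simps eval_nat_numeral)
qed

text \<open>
  The \<open>q\<close>-th power of the norm on one edge. Unlike the norm itself, it is additive over edges.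
\<close>

definition edge_Lq :: "('e \<Rightarrow> ennreal) \<Rightarrow> real \<Rightarrow> ('e \<Rightarrow> real \<Rightarrow> real) \<Rightarrow> 'e \<Rightarrow> real" where
  "edge_Lq len q u e = (LINT x:edge_interval len e|lborel. \<bar>u e x\<bar> powr q)"

lemma edge_Lq_nonneg [simp]: "0 \<le> edge_Lq len q u e"
  by (simp add: edge_Lq_def set_lebesgue_integral_def)

lemma Lq_norm_powr:
  "Lq_norm G len q u powr a = (\<Sum>e\<in>arcs G. edge_Lq len q u e) powr (a / q)"
  by (simp add: Lq_norm_def edge_Lq_def powr_powr)

lemma Lq_norm_power2: "(Lq_norm G len 2 u)\<^sup>2 = (\<Sum>e\<in>arcs G. edge_Lq len 2 u e)"
proof -
  have "(Lq_norm G len 2 u)\<^sup>2 = Lq_norm G len 2 u powr 2"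
    by (simp add: powr_numeral Lq_norm_def)
  then show ?thesis by (simp add: Lq_norm_powr sum_nonneg)
qed

lemma energy_eq:
  assumes "0 < p"
  shows "energy G len p u = 1 / 2 * (\<Sum>e\<in>arcs G. edge_Lq len 2 (graph_deriv len u) e)
     - 1 / p * (\<Sum>e\<in>arcs (compact_core G len). edge_Lq len p u e)"
  unfolding energy_def Lq_norm_power2 using assms
  by (simp add: Lq_norm_powr sum_nonneg)

text \<open>
  A parabolic arc on one half-line, extended by zero, does not meet the core and so has no
  potential energy. At fixed mass its kinetic energy decays like \<open>1 / r\<^sup>2\<close> when its support is
  stretched.
\<close>

lemma half_line_trial_function:
  assumes fin: "finite (arcs G)" and h: "h \<in> half_lines G len"
    and mu: "0 < \<mu>" and r: "0 < r" and p: "0 < p"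
  obtains v where "v \<in> H1_mass G len \<mu>" "energy G len p v = 5 * \<mu> / r\<^sup>2"
proof -
  \<comment> \<open>This amplitude normalises the mass \<open>c\<^sup>2 * r ^ 5 / 30\<close> to \<open>\<mu>\<close>.\<close>
  define c where "c = sqrt (30 * \<mu> / r ^ 5)"
  have c2: "c\<^sup>2 = 30 * \<mu> / r ^ 5" using mu r by (simp add: c_def)
  define v where "v e = (if e = h then (\<lambda>x. c * hump r x) else (\<lambda>_. 0))" for e
  define v' where "v' e = (if e = h then (\<lambda>x. c * hump' r x) else (\<lambda>_. 0))" for e
  have hG: "h \<in> arcs G" and inf: "len h = \<infinity>" using h by (simp_all add: half_lines_def)
  have Ih: "edge_interval len h = {0..}"
    using inf by (auto simp: edge_interval_def)
  have weak: "has_weak_deriv (edge_interval len e) (v e) (v' e)" for e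
    using has_weak_deriv_hump[OF r, of c] has_weak_deriv_zero by (simp add: v_def v'_def Ih)
  have L2: "L2_on (edge_interval len e) (v e)" for e
    using L2_on_hump L2_on_zero by (simp add: v_def Ih)
  have "continuous_on_graph G len v"
    unfolding continuous_on_graph_def
  proof (intro conjI ballI exI[of _ "\<lambda>_. 0"] impI)
    show "continuous_on (edge_interval len e) (v e)" for e
      by (auto simp: v_def hump_def[abs_def] intro!: continuous_intros)
    show "v e 0 = 0" for e by (simp add: v_def hump_def)
    show "v e (enn2real (len e)) = 0" if "len e < \<infinity>" for e
      using that inf by (auto simp: v_def)
  qed
  then have H1: "v \<in> H1 G len" using weak L2 by (auto simp: H1_def H1_on_def)
  have single: "(\<Sum>e\<in>arcs G. if e = h then a else 0) = (a :: real)" for a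
    using fin hG by simp
  have zero: "edge_Lq len q v e = 0" if "e \<noteq> h" for q e
    using that by (simp add: edge_Lq_def v_def set_lebesgue_integral_def)
  have mass: "edge_Lq len 2 v e = (if e = h then \<mu> else 0)" for e
    using zero[of e] hump_square_integral(1)[OF r, of c] r
    by (simp add: edge_Lq_def v_def Ih c2)
  have kin: "edge_Lq len 2 (graph_deriv len v) e = (if e = h then 10 * \<mu> / r\<^sup>2 else 0)" for e
  proof -
    have "edge_Lq len 2 (graph_deriv len v) e = (LINT x:edge_interval len e|lborel. \<bar>v' e x\<bar> powr 2)"
      unfolding edge_Lq_def graph_deriv_def by (rule weak_deriv_L2[OF weak])
    also have "\<dots> = (if e = h then 10 * \<mu> / r\<^sup>2 else 0)"
    proof (cases "e = h")
      case True
      then have "(LINT x:edge_interval len e|lborel. \<bar>v' e x\<bar> powr 2) = c\<^sup>2 * r ^ 3 / 3"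
        using hump_square_integral(2)[OF r, of c] by (simp add: v'_def Ih)
      also have "\<dots> = 10 * \<mu> / r\<^sup>2"
        unfolding c2 using r by (simp add: field_simps eval_nat_numeral)
      finally show ?thesis using True by simp
    qed (simp add: v'_def set_lebesgue_integral_def)
    finally show ?thesis .
  qed
  have "v \<in> H1_mass G len \<mu>"
    using H1 by (simp add: H1_mass_def Lq_norm_power2 mass single)
  moreover have "(\<Sum>e\<in>arcs (compact_core G len). edge_Lq len p v e) = 0"
    by (rule sum.neutral) (use h in \<open>auto simp: compact_core_def intro!: zero\<close>)
  then have "energy G len p v = 5 * \<mu> / r\<^sup>2"
    using p by (simp add: energy_eq kin single)
  ultimately show ?thesis by (rule that)
qed

lemma minimal_energy_nonpos:
  assumes "finite (arcs G)" "half_lines G len \<noteq> {}" "0 < \<mu>" "0 < p"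
    and min: "ereal (energy G len p u) = (INF v\<in>H1_mass G len \<mu>. ereal (energy G len p v))"
  shows "energy G len p u \<le> 0"
proof -
  obtain h where h: "h \<in> half_lines G len" using assms(2) by auto
  have "energy G len p u \<le> 5 * \<mu> / (real (Suc n))\<^sup>2" for n
  proof -
    obtain v where v: "v \<in> H1_mass G len \<mu>" "energy G len p v = 5 * \<mu> / (real (Suc n))\<^sup>2"
      using half_line_trial_function[OF assms(1) h assms(3) _ assms(4), of "real (Suc n)"]
      by auto
    have "ereal (energy G len p u) \<le> ereal (energy G len p v)"
      unfolding min using v(1) by (rule INF_lower)
    then show ?thesis using v(2) by simp
  qed
  moreover have "(\<lambda>n. 5 * \<mu> / (real (Suc n))\<^sup>2) \<longlonglongrightarrow> 0" by real_asymp
  ultimately show ?thesis by (intro LIMSEQ_le_const) auto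
qed

section \<open>Bounds on the core by the Gagliardo--Nirenberg inequalities\<close>

lemma AE_le_Linf_norm:
  assumes le: "Linf_norm G len u \<le> ennreal M" and M: "0 \<le> M" and e: "e \<in> arcs G"
  shows "AE x in lborel. x \<in> edge_interval len e \<longrightarrow> \<bar>u e x\<bar> \<le> M"
proof -
  let ?R = "restrict_space lborel (edge_interval len e)"
  have "esssup ?R (\<lambda>x. ennreal \<bar>u e x\<bar>) \<le> Linf_norm G len u"
    unfolding Linf_norm_def using e by (rule SUP_upper)
  also note le
  finally have sup: "esssup ?R (\<lambda>x. ennreal \<bar>u e x\<bar>) \<le> ennreal M" .
  have "AE x in ?R. ennreal \<bar>u e x\<bar> \<le> esssup ?R (\<lambda>x. ennreal \<bar>u e x\<bar>)"
    by (rule esssup_AE)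
  then have "AE x in ?R. \<bar>u e x\<bar> \<le> M"
  proof eventually_elim
    case (elim x)
    then have "ennreal \<bar>u e x\<bar> \<le> ennreal M" using sup by (rule order_trans)
    then show ?case using M by simp
  qed
  then show ?thesis by (simp add: AE_restrict_space_iff)
qed

lemma edge_Lq_le:
  assumes M: "AE x in lborel. x \<in> edge_interval len e \<longrightarrow> \<bar>u e x\<bar> \<le> M"
    and len: "len e < \<infinity>" and q: "0 \<le> q"
  shows "edge_Lq len q u e \<le> M powr q * enn2real (len e)"
proof -
  obtain l where l: "0 \<le> l" "len e = ennreal l" "edge_interval len e = {0..l}"
    using len by (cases rule: edge_interval_cases[of len e]) auto
  have "edge_Lq len q u e \<le> (LINT x|lborel. indicat_real {0..l} x * M powr q)"
    unfolding edge_Lq_def set_lebesgue_integral_def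
  proof (rule integral_mono_AE')
    show "integrable lborel (\<lambda>x. indicat_real {0..l} x * M powr q)"
      using borel_integrable_atLeastAtMost'[of 0 l "\<lambda>_. M powr q"] by (simp add: set_integrable_def)
    show "AE x in lborel. indicat_real (edge_interval len e) x *\<^sub>R \<bar>u e x\<bar> powr q \<le> indicat_real {0..l} x * M powr q"
      using M by eventually_elim (auto simp: l(3) indicator_def q intro!: powr_mono2)
    show "AE x in lborel. 0 \<le> indicat_real {0..l} x * M powr q"
      by simp
  qed
  also have "\<dots> = M powr q * enn2real (len e)"
    using l by simp
  finally show ?thesis .
qed

lemma edge_Lq_eq_0:
  assumes "AE x in lborel. x \<in> edge_interval len e \<longrightarrow> \<bar>u e x\<bar> \<le> 0"
  shows "edge_Lq len q u e = 0"
  unfolding edge_Lq_def set_lebesgue_integral_def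
  by (rule integral_eq_zero_AE) (use assms in eventually_elim, auto simp: indicator_def)

text \<open>
  The bound on the essential supremum in terms of the squared norms \<open>m\<close> and \<open>t\<close>, which add up over
  the pieces of a partition.
\<close>

lemma graph_Linf_bound:
  assumes GN: "GN_const_Linf C" "0 < C" and H: "core_with_half_lines H len" "half_lines H len \<noteq> {}"
    and u: "u \<in> H1 H len" and e: "e \<in> arcs H"
    and mass: "m = (\<Sum>e\<in>arcs H. edge_Lq len 2 u e)"
    and kin: "t = (\<Sum>e\<in>arcs H. edge_Lq len 2 (graph_deriv len u) e)"
  shows "AE x in lborel. x \<in> edge_interval len e \<longrightarrow> \<bar>u e x\<bar> \<le> C * m powr (1/4) * t powr (1/4)"
proof (rule AE_le_Linf_norm[OF _ _ e])
  show "Linf_norm H len u \<le> ennreal (C * m powr (1/4) * t powr (1/4))"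
    using GN_const_LinfD[OF GN(1) H u] by (simp add: Lq_norm_powr mass kin)
qed (use GN in simp)

text \<open>
  On edges of finite length the potential energy is at most the \<open>p\<close>-th power of the supremum times
  the total length. This is where the measure of the core enters.
\<close>

lemma core_Lp_bound:
  assumes GN: "GN_const_Linf C" "0 < C" and H: "core_with_half_lines H len" "half_lines H len \<noteq> {}"
    and u: "u \<in> H1 H len" and p: "0 \<le> p"
    and mass: "m = (\<Sum>e\<in>arcs H. edge_Lq len 2 u e)"
    and kin: "t = (\<Sum>e\<in>arcs H. edge_Lq len 2 (graph_deriv len u) e)"
    and F: "F \<subseteq> arcs H" "\<And>e. e \<in> F \<Longrightarrow> len e < \<infinity>"
  shows "(\<Sum>e\<in>F. edge_Lq len p u e) \<le> C powr p * m powr (p/4) * t powr (p/4) * (\<Sum>e\<in>F. enn2real (len e))"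
proof -
  have m: "0 \<le> m" and t: "0 \<le> t" by (simp_all add: mass kin sum_nonneg)
  have "(\<Sum>e\<in>F. edge_Lq len p u e) \<le> (\<Sum>e\<in>F. (C * m powr (1/4) * t powr (1/4)) powr p * enn2real (len e))"
    by (intro sum_mono edge_Lq_le graph_Linf_bound[OF GN H u _ mass kin]) (use F p in auto)
  also have "(C * m powr (1/4) * t powr (1/4)) powr p = C powr p * m powr (p/4) * t powr (p/4)"
    using GN m t by (simp add: powr_mult powr_powr)
  finally show ?thesis by (simp add: sum_distrib_left)
qed

text \<open>
  A function of zero kinetic energy vanishes by the supremum bound: there is no nonzero constant in
  \<open>H\<^sup>1\<close> of a graph with a half-line.
\<close>

lemma H1_kinetic_pos:
  assumes GN: "GN_const_Linf C" "0 < C" and G: "core_with_half_lines G len" "half_lines G len \<noteq> {}"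
    and u: "u \<in> H1 G len" and mass: "0 < (\<Sum>e\<in>arcs G. edge_Lq len 2 u e)"
  shows "0 < (\<Sum>e\<in>arcs G. edge_Lq len 2 (graph_deriv len u) e)"
proof (rule ccontr)
  assume "\<not> ?thesis"
  then have t: "(\<Sum>e\<in>arcs G. edge_Lq len 2 (graph_deriv len u) e) = 0"
    by (simp add: not_less sum_nonneg order_antisym)
  have "edge_Lq len 2 u e = 0" if "e \<in> arcs G" for e
    by (rule edge_Lq_eq_0) (use graph_Linf_bound[OF GN G u that refl refl] in \<open>simp add: t\<close>)
  then have "(\<Sum>e\<in>arcs G. edge_Lq len 2 u e) = 0" by simp
  with mass show False by simp
qed

lemma core_Lp_le_GN:
  assumes GN: "GN_const_Lp p C" and G: "core_with_half_lines G len" "half_lines G len \<noteq> {}"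
    and u: "u \<in> H1 G len" and p: "0 < p"
    and mass: "m = (\<Sum>e\<in>arcs G. edge_Lq len 2 u e)"
    and kin: "t = (\<Sum>e\<in>arcs G. edge_Lq len 2 (graph_deriv len u) e)"
  shows "(\<Sum>e\<in>arcs (compact_core G len). edge_Lq len p u e) \<le> C * m powr ((p + 2) / 4) * t powr ((p - 2) / 4)"
proof -
  interpret core_with_half_lines G len by fact
  have "(\<Sum>e\<in>arcs (compact_core G len). edge_Lq len p u e) \<le> (\<Sum>e\<in>arcs G. edge_Lq len p u e)"
    by (rule sum_mono2) auto
  also have "\<dots> = Lq_norm G len p u powr p"
    using p by (simp add: Lq_norm_powr sum_nonneg)
  also have "\<dots> \<le> C * m powr ((p / 2 + 1) / 2) * t powr ((p / 2 - 1) / 2)"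
    using GN_const_LpD[OF GN G u] by (simp only: Lq_norm_powr mass kin)
  finally show ?thesis by (simp add: add_divide_distrib diff_divide_distrib)
qed

section \<open>The arithmetic of the threshold\<close>

text \<open>
  Since \<open>p \<ge> 4\<close>, the energy bound gives \<open>2 * T \<le> A\<close>. Then \<open>GN\<close> bounds \<open>T powr ((6 - p) / 4)\<close> by
  \<open>Cp * \<mu> powr ((p + 2) / 4)\<close>, while \<open>core\<close> bounds \<open>2 * T powr (1 - p / 4)\<close> by
  \<open>Cinf powr p * threshold_L2 p \<mu> Cp Cinf * \<mu> powr (p / 4)\<close>. The threshold is the value at which
  eliminating \<open>T\<close> between the two cancels all other quantities and leaves \<open>2 \<le> 1\<close>. The
  relation is linear in the logarithms of the quantities.
\<close>

lemma threshold_contradiction: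
  fixes p \<mu> T A Cp Cinf :: real
  assumes p: "4 \<le> p" "p < 6" and pos: "0 < \<mu>" "0 < T" "0 < Cp" "0 < Cinf"
    and energy: "T / 2 \<le> A / p"
    and GN: "A \<le> Cp * \<mu> powr ((p + 2) / 4) * T powr ((p - 2) / 4)"
    and core: "A \<le> Cinf powr p * threshold_L2 p \<mu> Cp Cinf * \<mu> powr (p/4) * T powr (p/4)"
  shows False
proof -
  have A0: "0 < A" using energy pos p by (smt (verit) divide_nonpos_pos half_gt_zero)
  have "A / p \<le> A / 4" using A0 p by (intro divide_left_mono) auto
  then have TA: "2 * T \<le> A" using energy by linarith
  define t m c d where defs: "t = ln T" "m = ln \<mu>" "c = ln Cp" "d = ln Cinf"
  have "ln (2 * T) \<le> ln A" using TA pos by (intro ln_mono) auto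
  then have lnA: "ln 2 + t \<le> ln A" using pos by (simp add: ln_mult defs)
  have "ln A \<le> ln (Cp * \<mu> powr ((p + 2) / 4) * T powr ((p - 2) / 4))"
    using GN A0 by (intro ln_mono) auto
  also have "\<dots> = c + (p + 2) / 4 * m + (p - 2) / 4 * t"
    using pos by (simp add: ln_mult ln_powr defs)
  finally have 1: "t \<le> c + (p + 2) / 4 * m + (p - 2) / 4 * t" using lnA ln_gt_zero[of 2] by linarith
  have L: "0 < threshold_L2 p \<mu> Cp Cinf" using pos by (simp add: threshold_L2_def)
  have lnL: "ln (threshold_L2 p \<mu> Cp Cinf) = (2 - p) / (6 - p) * m + (4 - p) / (6 - p) * c - p * d"
    using pos by (simp add: threshold_L2_def ln_mult ln_powr defs)
  have "ln A \<le> ln (Cinf powr p * threshold_L2 p \<mu> Cp Cinf * \<mu> powr (p/4) * T powr (p/4))"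
    using core A0 by (intro ln_mono) auto
  also have "\<dots> = p * d + ln (threshold_L2 p \<mu> Cp Cinf) + p / 4 * m + p / 4 * t"
    using pos L by (simp add: ln_mult ln_powr defs)
  finally have 2: "ln 2 + t \<le> (2 - p) / (6 - p) * m + (4 - p) / (6 - p) * c + p / 4 * m + p / 4 * t"
    using lnA lnL by linarith
  \<comment> \<open>Clear the denominators and eliminate \<open>t\<close>; the terms in \<open>m\<close> and \<open>c\<close> then cancel.\<close>
  have "(6 - p) * t \<le> 4 * c + (p + 2) * m" using 1 by (simp add: field_simps)
  then have 3: "(p - 4) * ((6 - p) * t) \<le> (p - 4) * (4 * c + (p + 2) * m)"
    using p by (intro mult_left_mono) auto
  define X Y where XY: "X = (2 - p) / (6 - p)" "Y = (4 - p) / (6 - p)"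
  have XY': "X * (6 - p) = 2 - p" "Y * (6 - p) = 4 - p" using p by (simp_all add: XY)
  define w where "w = ln 2 * (6 - p)"
  have "4 * w + t * (4 * (6 - p)) = (ln 2 + t) * (4 * (6 - p))" by (simp add: w_def algebra_simps)
  also have "\<dots> \<le> (X * m + Y * c + p / 4 * m + p / 4 * t) * (4 * (6 - p))"
    using 2 p unfolding XY by (intro mult_right_mono) auto
  also have "\<dots> = 4 * (X * (6 - p)) * m + 4 * (Y * (6 - p)) * c + p * (6 - p) * m + p * (6 - p) * t"
    by (simp add: algebra_simps)
  finally have "w \<le> 0" using 3 unfolding XY' by (simp add: algebra_simps)
  then show False using p by (simp add: w_def mult_le_0_iff)
qed

text \<open>
  Superadditivity of \<open>s powr a\<close> for \<open>a \<ge> 1\<close>: splitting the mass and the kinetic energy into pieces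
  can only decrease the sum of these products. With \<open>a = p / 4\<close> this is where \<open>p \<ge> 4\<close> lets the
  largest piece of the core alone decide.
\<close>

lemma sum_powr_mult_powr_le:
  fixes m t :: "'i \<Rightarrow> real"
  assumes "1 \<le> a" "0 < T"
    and m: "\<And>i. i \<in> I \<Longrightarrow> 0 \<le> m i \<and> m i \<le> \<mu>"
    and t: "\<And>i. i \<in> I \<Longrightarrow> 0 \<le> t i \<and> t i \<le> T" and sum: "(\<Sum>i\<in>I. t i) \<le> T"
  shows "(\<Sum>i\<in>I. m i powr a * t i powr a) \<le> \<mu> powr a * T powr a"
proof -
  have split: "s powr a = s powr (a - 1) * s" if "0 \<le> s" for s :: real
    using that assms(1) by (cases "s = 0") (auto simp: powr_diff)
  have "(\<Sum>i\<in>I. m i powr a * t i powr a) \<le> (\<Sum>i\<in>I. \<mu> powr a * (T powr (a - 1) * t i))"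
  proof (rule sum_mono)
    fix i assume i: "i \<in> I"
    have "t i powr a = t i powr (a - 1) * t i" using t i by (intro split) auto
    also have "\<dots> \<le> T powr (a - 1) * t i"
      using t i assms(1) by (intro mult_right_mono powr_mono2) auto
    finally show "m i powr a * t i powr a \<le> \<mu> powr a * (T powr (a - 1) * t i)"
      using m t i assms(1) by (intro mult_mono powr_mono2) auto
  qed
  also have "\<dots> = \<mu> powr a * (T powr (a - 1) * (\<Sum>i\<in>I. t i))"
    by (simp add: sum_distrib_left)
  also have "\<dots> \<le> \<mu> powr a * (T powr (a - 1) * T)"
    using sum by (intro mult_left_mono) auto
  also have "\<dots> = \<mu> powr a * T powr a" using split[of T] assms(2) by simp
  finally show ?thesis .
qed

section \<open>Partitions with small cores\<close>

lemma H1_subgraph: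
  assumes "subgraph H G" "u \<in> H1 G len"
  shows "u \<in> H1 H len"
proof -
  have "arcs H \<subseteq> arcs G" "tail H = tail G" "head H = head G"
    using assms(1) by (auto simp: subgraph_def compatible_def)
  then show ?thesis using assms(2) unfolding H1_def continuous_on_graph_def
    by (auto; blast)
qed

lemma meas_zero_arcs_empty:
  assumes "meas G len = 0" "finite (arcs G)" "\<And>e. e \<in> arcs G \<Longrightarrow> 0 < len e"
  shows "arcs G = {}"
  using assms by (auto simp: meas_def)

lemma sum_enn2real_less:
  assumes "(\<Sum>e\<in>F. f e) < ennreal L" "\<And>e. e \<in> F \<Longrightarrow> f e < \<infinity>"
  shows "(\<Sum>e\<in>F. enn2real (f e)) < L"
proof -
  have "ennreal (\<Sum>e\<in>F. enn2real (f e)) = (\<Sum>e\<in>F. ennreal (enn2real (f e)))"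
    by (rule sum_ennreal[symmetric]) simp
  also have "\<dots> = (\<Sum>e\<in>F. f e)" using assms(2) by (intro sum.cong) auto
  finally have "ennreal (\<Sum>e\<in>F. enn2real (f e)) < ennreal L" using assms(1) by simp
  then show ?thesis by (simp add: ennreal_less_iff sum_nonneg)
qed

theorem corollary3p6:
  fixes G :: "('v, 'e) pre_digraph"
    and len :: "'e \<Rightarrow> ennreal"
    and \<mu> p Cp Cinf :: real
    and \<nu> :: nat
    and Gs :: "nat \<Rightarrow> ('v, 'e) pre_digraph"
  assumes "0 < \<mu>"
    and "4 \<le> p" "p < 6"
    and "0 < Cp" "GN_const_Lp p Cp"
    and "0 < Cinf" "GN_const_Linf Cinf"
    and "core_with_half_lines G len"
    and "arcs (compact_core G len) \<noteq> {}"
    and "2 \<le> card (half_lines G len)"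
    and "graph_partition G len \<nu> Gs"
    and "\<And>i. i \<in> {1..\<nu>} \<Longrightarrow>
           meas (graph_inter (Gs i) (compact_core G len)) len < ennreal (threshold_L2 p \<mu> Cp Cinf)"
  shows "\<not> (\<exists>u\<in>H1_mass G len \<mu>.
             ereal (energy G len p u) = (INF v\<in>H1_mass G len \<mu>. ereal (energy G len p v)))"
proof
  assume "\<exists>u\<in>H1_mass G len \<mu>.
             ereal (energy G len p u) = (INF v\<in>H1_mass G len \<mu>. ereal (energy G len p v))"
  then obtain u where uM: "u \<in> H1_mass G len \<mu>"
    and min: "ereal (energy G len p u) = (INF v\<in>H1_mass G len \<mu>. ereal (energy G len p v))" ..
  interpret core_with_half_lines G len by fact
  have hl: "half_lines G len \<noteq> {}" using assms(10) by auto
  have p0: "0 < p" using assms(2) by simp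
  define T where "T = (\<Sum>e\<in>arcs G. edge_Lq len 2 (graph_deriv len u) e)"
  define A where "A = (\<Sum>e\<in>arcs (compact_core G len). edge_Lq len p u e)"
  have u: "u \<in> H1 G len" and mass: "\<mu> = (\<Sum>e\<in>arcs G. edge_Lq len 2 u e)"
    using uM by (auto simp: H1_mass_def Lq_norm_power2)
  have T: "0 < T"
    unfolding T_def using H1_kinetic_pos[OF assms(7,6,8) hl u] assms(1) mass by simp
  have "energy G len p u \<le> 0"
    by (rule minimal_energy_nonpos[OF finite_arcs hl assms(1) p0 min])
  then have energy: "T / 2 \<le> A / p" by (simp add: energy_eq[OF p0] T_def A_def)
  have GN: "A \<le> Cp * \<mu> powr ((p + 2) / 4) * T powr ((p - 2) / 4)"
    unfolding A_def by (rule core_Lp_le_GN[OF assms(5,8) hl u p0 mass T_def])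

  have part: "subgraph (Gs i) G" "arcs (Gs i) \<noteq> {}" "Digraph_Component.connected (Gs i)"
      "\<exists>h\<in>half_lines G len. h \<in> arcs (Gs i)" if "i \<in> {1..\<nu>}" for i
    using assms(11) that unfolding graph_partition_def by blast+
  have un: "arcs G = (\<Union>i\<in>{1..\<nu>}. arcs (Gs i))"
  proof -
    have "pre_digraph.Union G (Gs ` {1..\<nu>}) = G" using assms(11) by (simp add: graph_partition_def)
    then have "arcs G = arcs (pre_digraph.Union G (Gs ` {1..\<nu>}))" by simp
    then show ?thesis by (simp add: Union_def)
  qed
  have sub: "arcs (Gs i) \<subseteq> arcs G" if "i \<in> {1..\<nu>}" for i using part(1)[OF that] by (simp add: subgraph_def)
  have fin: "finite (arcs (Gs i))" if "i \<in> {1..\<nu>}" for i using sub[OF that] finite_arcs by (rule finite_subset)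
  have disj: "arcs (Gs i) \<inter> arcs (Gs j) = {}" if "i \<in> {1..\<nu>}" "j \<in> {1..\<nu>}" "i \<noteq> j" for i j
  proof -
    have "meas (graph_inter (Gs i) (Gs j)) len = 0"
      using assms(11) that unfolding graph_partition_def by blast
    from meas_zero_arcs_empty[OF this] show ?thesis
      using fin[OF that(1)] sub[OF that(1)] len_pos by (auto simp: graph_inter_def)
  qed
  have sum_pieces: "(\<Sum>e\<in>arcs G. f e) = (\<Sum>i\<in>{1..\<nu>}. \<Sum>e\<in>arcs (Gs i). f e)" for f :: "'e \<Rightarrow> real"
    unfolding un by (rule sum.UNION_disjoint) (use fin disj in auto)

  define m where "m i = (\<Sum>e\<in>arcs (Gs i). edge_Lq len 2 u e)" for i
  define t where "t i = (\<Sum>e\<in>arcs (Gs i). edge_Lq len 2 (graph_deriv len u) e)" for i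
  define K where "K i = arcs (Gs i) \<inter> arcs (compact_core G len)" for i
  let ?L = "threshold_L2 p \<mu> Cp Cinf"
  have "A = (\<Sum>i\<in>{1..\<nu>}. \<Sum>e\<in>K i. edge_Lq len p u e)"
  proof -
    have K_un: "arcs (compact_core G len) = (\<Union>i\<in>{1..\<nu>}. K i)"
      using un by (auto simp: K_def)
    show ?thesis unfolding A_def K_un
      by (rule sum.UNION_disjoint) (use fin disj in \<open>auto simp: K_def disjoint_iff\<close>)
  qed
  also have "\<dots> \<le> (\<Sum>i\<in>{1..\<nu>}. Cinf powr p * ?L * (m i powr (p/4) * t i powr (p/4)))"
  proof (rule sum_mono)
    fix i assume i: "i \<in> {1..\<nu>}"
    have Hi: "core_with_half_lines (Gs i) len"
      by (rule connected_subgraph_core_with_half_lines[OF part(1,3,2)[OF i]])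
    have hli: "half_lines (Gs i) len \<noteq> {}"
      using part(4)[OF i] by (auto simp: half_lines_def)
    have finK: "len e < \<infinity>" if "e \<in> K i" for e
      using that by (auto simp: K_def half_lines_def less_top)
    have "(\<Sum>e\<in>K i. len e) < ennreal ?L"
      using assms(12)[OF i] by (simp add: meas_def graph_inter_def K_def)
    then have len_K: "(\<Sum>e\<in>K i. enn2real (len e)) < ?L"
      by (rule sum_enn2real_less) (rule finK)
    have "(\<Sum>e\<in>K i. edge_Lq len p u e)
        \<le> Cinf powr p * m i powr (p/4) * t i powr (p/4) * (\<Sum>e\<in>K i. enn2real (len e))"
      by (rule core_Lp_bound[OF assms(7,6) Hi hli H1_subgraph[OF part(1)[OF i] u] _ m_def t_def])
         (use p0 finK in \<open>auto simp: K_def\<close>)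
    also have "\<dots> \<le> Cinf powr p * m i powr (p/4) * t i powr (p/4) * ?L"
      using len_K by (intro mult_left_mono) auto
    finally show "(\<Sum>e\<in>K i. edge_Lq len p u e) \<le> Cinf powr p * ?L * (m i powr (p/4) * t i powr (p/4))"
      by (simp add: mult_ac)
  qed
  also have "\<dots> = Cinf powr p * ?L * (\<Sum>i\<in>{1..\<nu>}. m i powr (p/4) * t i powr (p/4))"
    by (simp add: sum_distrib_left)
  also have "\<dots> \<le> Cinf powr p * ?L * (\<mu> powr (p/4) * T powr (p/4))"
  proof (intro mult_left_mono sum_powr_mult_powr_le)
    show "0 \<le> m i \<and> m i \<le> \<mu>" if "i \<in> {1..\<nu>}" for i
      unfolding m_def mass using sub[OF that] by (auto intro!: sum_nonneg sum_mono2)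
    show "0 \<le> t i \<and> t i \<le> T" if "i \<in> {1..\<nu>}" for i
      unfolding t_def T_def using sub[OF that] by (auto intro!: sum_nonneg sum_mono2)
    show "(\<Sum>i\<in>{1..\<nu>}. t i) \<le> T" by (simp add: T_def t_def sum_pieces)
    show "0 \<le> Cinf powr p * ?L" by (simp add: threshold_L2_def)
  qed (use assms(2) T in auto)
  finally have "A \<le> Cinf powr p * ?L * \<mu> powr (p/4) * T powr (p/4)" by (simp add: mult_ac)
  from threshold_contradiction[OF assms(2,3,1) T assms(4,6) energy GN this] show False .
qed

end
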